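(* Let $(M,\mathcal{T})$ be a triangulated closed 3-manifold with $N$ vertices. Given any initial data $\pmb{r}(0)\in\mathbb{R}^N_+$, the solution $\pmb{r}(t)\in\mathbb{R}^N_+$ to the extended combinatorial Yamabe flow $$\frac{dr_i}{dt}=-\widetilde{K}_i\sinh r_i,\qquad i\in\mathcal{T}_0,$$ is unique; that is, any two solutions with the same initial data coincide on their common interval of existence $[0,T)$.
   Context: $M$ is a closed 3-manifold with a (finite) triangulation $\mathcal{T}=\{\mathcal{T}_0,\mathcal{T}_1,\mathcal{T}_2,\mathcal{T}_3\}$ (vertices, edges, faces, tetrahedra), $\mathcal{T}_0=\{1,\dots,N\}$; $\{ijkl\}\in\mathcal{T}_3$ denotes the tetrahedron with vertices $i,j,k,l$. $\mathbb{R}_+=(0,\infty)$. A (hyperbolic) ball packing is a vector $\pmb{r}=(r_1,\dots,r_N)\in\mathbb{R}^N_+$. For $(r_i,r_j,r_k,r_l)\in\mathbb{R}_+^4$ write $y_a=\coth r_a$ and $Q=(y_i+y_j+y_k+y_l)^2-2(y_i^2+y_j^2+y_k^2+y_l^2)+4$. A non-degenerate tetrahedron in $\mathbb{H}^3$ (curvature $-1$) with edge lengths $l_{ab}=r_a+r_b$ exists iff $Q>0$ and is then unique up to isometry; $\alpha_{ijkl}$ is then its solid angle at $i$ (sum of the three dihedral angles at the edges through $i$, minus $\pi$). The set $\{Q\le 0\}\subset\mathbb{R}_+^4$ is the disjoint union of the four sets $D_a$, $a\in\{i,j,k,l\}$, where $D_a=\{y_a\geq y_b+y_c+y_d+2(y_by_c+y_cy_d+y_dy_b+1)^{1/2}\}$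 with $\{a,b,c,d\}=\{i,j,k,l\}$. The extended solid angle at $i$ is $\widetilde\alpha_{ijkl}=\alpha_{ijkl}$ if $Q>0$, $\widetilde\alpha_{ijkl}=2\pi$ on $D_i$, and $\widetilde\alpha_{ijkl}=0$ on $D_j\cup D_k\cup D_l$. The extended combinatorial scalar curvature is $\widetilde{K}_i=4\pi-\sum\widetilde{\alpha}_{ijkl}$, summed over all tetrahedra incident to $i$; in the flow it is evaluated at $\pmb r(t)$. *)

theory Defs
  imports "HOL-Analysis.Analysis"
begin

section \<open>Triangulated closed 3-manifolds\<close>

text \<open>Closed means compact without boundary; connectedness is not required.\<close>

definition closed_3_manifold :: "'m topology \<Rightarrow> bool" where
  "closed_3_manifold M \<longleftrightarrow>
     compact_space M \<and> Hausdorff_space M \<and> second_countable M \<and>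
     (\<forall>x\<in>topspace M. \<exists>U (V :: (real^3) set).
        openin M U \<and> x \<in> U \<and> open V \<and>
        subtopology M U homeomorphic_space subtopology euclidean V)"

text \<open>An abstract simplicial complex with vertex set \<open>{1..N}\<close>, given by its nonempty
  simplices, each identified with the set of its vertices.\<close>

definition simplicial_complex_on :: "nat \<Rightarrow> nat set set \<Rightarrow> bool" where
  "simplicial_complex_on N \<T> \<longleftrightarrow>
     {} \<notin> \<T> \<and> \<Union>\<T> = {1..N} \<and>
     (\<forall>\<sigma>\<in>\<T>. \<forall>\<tau>. \<tau> \<subseteq> \<sigma> \<and> \<tau> \<noteq> {} \<longrightarrow> \<tau> \<in> \<T>)"

definition simplices :: "nat set set \<Rightarrow> nat \<Rightarrow> nat set set" where
  "simplices \<T> d = {\<sigma> \<in> \<T>. card \<sigma> = d + 1}"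

text \<open>The points are given by their barycentric coordinates, extended by zero. For finite
  complexes the product topology is the usual topology of the realization.\<close>

definition geometric_realization :: "nat set set \<Rightarrow> (nat \<Rightarrow> real) topology" where
  "geometric_realization \<T> =
     subtopology (powertop_real UNIV)
       {x. (\<forall>i. 0 \<le> x i) \<and> {i. x i \<noteq> 0} \<in> \<T> \<and> sum x {i. x i \<noteq> 0} = 1}"

definition triangulated_closed_3_manifold :: "'m topology \<Rightarrow> nat \<Rightarrow> nat set set \<Rightarrow> bool" where
  "triangulated_closed_3_manifold M N \<T> \<longleftrightarrow>
     closed_3_manifold M \<and> simplicial_complex_on N \<T> \<and>
     \<T> = simplices \<T> 0 \<union> simplices \<T> 1 \<union> simplices \<T> 2 \<union> simplices \<T> 3 \<and>
     geometric_realization \<T> homeomorphic_space M"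


section \<open>Hyperbolic tetrahedra and solid angles\<close>

text \<open>Hyperbolic 3-space of curvature \<open>-1\<close> in the hyperboloid model; the second
  component is the time-like one.\<close>

type_synonym minkowski = "(real^3) \<times> real"

definition lorentz :: "minkowski \<Rightarrow> minkowski \<Rightarrow> real" where
  "lorentz p q = fst p \<bullet> fst q - snd p * snd q"

definition hyperbolic_space :: "minkowski set" where
  "hyperbolic_space = {p. lorentz p p = -1 \<and> snd p > 0}"

definition hyp_dist :: "minkowski \<Rightarrow> minkowski \<Rightarrow> real" where
  "hyp_dist p q = arcosh (- lorentz p q)"

text \<open>The component of \<open>v\<close> orthogonal to \<open>a\<close> (for \<open>lorentz a a \<noteq> 0\<close>). In particular, for
  distinct points \<open>p\<close>, \<open>q\<close> of hyperbolic space, \<open>lorentz_perp p q\<close> is a tangent vector at \<open>p\<close>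
  pointing along the geodesic from \<open>p\<close> to \<open>q\<close>.\<close>

definition lorentz_perp :: "minkowski \<Rightarrow> minkowski \<Rightarrow> minkowski" where
  "lorentz_perp a v = v - (lorentz a v / lorentz a a) *\<^sub>R a"

definition lorentz_angle :: "minkowski \<Rightarrow> minkowski \<Rightarrow> real" where
  "lorentz_angle u v = arccos (lorentz u v / (sqrt (lorentz u u) * sqrt (lorentz v v)))"

text \<open>The dihedral angle at the edge \<open>pq\<close> of the tetrahedron \<open>pqab\<close>: the angle, in the tangent
  space at \<open>p\<close>, between the vectors that are orthogonal to the edge and point into the faces
  \<open>pqa\<close> and \<open>pqb\<close>.\<close>

definition dihedral_angle ::
  "minkowski \<Rightarrow> minkowski \<Rightarrow> minkowski \<Rightarrow> minkowski \<Rightarrow> real" where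
  "dihedral_angle p q a b =
     (let e = lorentz_perp p q
      in lorentz_angle (lorentz_perp e (lorentz_perp p a)) (lorentz_perp e (lorentz_perp p b)))"

definition tetrahedron_solid_angle ::
  "minkowski \<Rightarrow> minkowski \<Rightarrow> minkowski \<Rightarrow> minkowski \<Rightarrow> real" where
  "tetrahedron_solid_angle p q a b =
     dihedral_angle p q a b + dihedral_angle p a q b + dihedral_angle p b q a - pi"

text \<open>Hyperbolic planes are the nonempty intersections of hyperbolic space with 3-dimensional linear
  subspaces, so linear independence says that the four vertices do not lie in a plane.\<close>

definition nondegenerate_tetrahedron ::
  "minkowski \<Rightarrow> minkowski \<Rightarrow> minkowski \<Rightarrow> minkowski \<Rightarrow> bool" where
  "nondegenerate_tetrahedron p q a b \<longleftrightarrow>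
     {p, q, a, b} \<subseteq> hyperbolic_space \<and> distinct [p, q, a, b] \<and> independent {p, q, a, b}"

definition ball_packing_tetrahedron ::
  "real \<Rightarrow> real \<Rightarrow> real \<Rightarrow> real \<Rightarrow>
   minkowski \<Rightarrow> minkowski \<Rightarrow> minkowski \<Rightarrow> minkowski \<Rightarrow> bool" where
  "ball_packing_tetrahedron ri rj rk rl p q a b \<longleftrightarrow>
     nondegenerate_tetrahedron p q a b \<and>
     hyp_dist p q = ri + rj \<and> hyp_dist p a = ri + rk \<and> hyp_dist p b = ri + rl \<and>
     hyp_dist q a = rj + rk \<and> hyp_dist q b = rj + rl \<and> hyp_dist a b = rk + rl"

text \<open>In the next definitions the first argument belongs to the vertex \<open>i\<close> at which the angle is
  taken; they are symmetric in the other three. The description in \<open>solid_angle\<close> is proper if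
  \<open>Q_form > 0\<close>.\<close>

definition solid_angle :: "real \<Rightarrow> real \<Rightarrow> real \<Rightarrow> real \<Rightarrow> real" where
  "solid_angle ri rj rk rl =
     (THE \<theta>. \<exists>p q a b. ball_packing_tetrahedron ri rj rk rl p q a b \<and>
        \<theta> = tetrahedron_solid_angle p q a b)"

definition coth :: "real \<Rightarrow> real" where
  "coth x = cosh x / sinh x"

definition Q_form :: "real \<Rightarrow> real \<Rightarrow> real \<Rightarrow> real \<Rightarrow> real" where
  "Q_form ri rj rk rl =
     (coth ri + coth rj + coth rk + coth rl)\<^sup>2
     - 2 * ((coth ri)\<^sup>2 + (coth rj)\<^sup>2 + (coth rk)\<^sup>2 + (coth rl)\<^sup>2) + 4"

definition degenerate_at :: "real \<Rightarrow> real \<Rightarrow> real \<Rightarrow> real \<Rightarrow> bool" where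
  "degenerate_at ra rb rc rd \<longleftrightarrow>
     coth ra \<ge> coth rb + coth rc + coth rd
       + 2 * sqrt (coth rb * coth rc + coth rc * coth rd + coth rd * coth rb + 1)"

text \<open>For positive radii, \<open>{Q_form \<le> 0}\<close> is the disjoint union of the four sets given by
  \<open>degenerate_at\<close>, so the last branch is the region where one of the other three vertices
  is the degenerate one.\<close>

definition ext_solid_angle :: "real \<Rightarrow> real \<Rightarrow> real \<Rightarrow> real \<Rightarrow> real" where
  "ext_solid_angle ri rj rk rl =
     (if Q_form ri rj rk rl > 0 then solid_angle ri rj rk rl
      else if degenerate_at ri rj rk rl then 2 * pi
      else 0)"


section \<open>The extended combinatorial Yamabe flow\<close>

text \<open>The condition \<open>j < k < l\<close> makes each tetrahedron incident to \<open>i\<close> occur exactly once; that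
  \<open>i\<close> is not among \<open>j\<close>, \<open>k\<close>, \<open>l\<close> follows from \<open>card {i, j, k, l} = 4\<close>.\<close>

definition ext_scalar_curvature :: "nat set set \<Rightarrow> (nat \<Rightarrow> real) \<Rightarrow> nat \<Rightarrow> real" where
  "ext_scalar_curvature \<T> r i =
     4 * pi - (\<Sum>(j, k, l) \<in> {(j, k, l). j < k \<and> k < l \<and> {i, j, k, l} \<in> simplices \<T> 3}.
                 ext_solid_angle (r i) (r j) (r k) (r l))"

text \<open>A solution on \<open>[0, T)\<close>, where \<open>T = \<infinity>\<close> is allowed; the derivative at time \<open>0\<close> is one-sided.
  Only the values \<open>r t i\<close> at vertices \<open>i \<in> {1..N}\<close> are relevant.\<close>

definition ext_yamabe_flow_solution ::
  "nat \<Rightarrow> nat set set \<Rightarrow> (nat \<Rightarrow> real) \<Rightarrow> ereal \<Rightarrow> (real \<Rightarrow> nat \<Rightarrow> real) \<Rightarrow> bool" where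
  "ext_yamabe_flow_solution N \<T> r0 T r \<longleftrightarrow>
     (\<forall>i\<in>{1..N}. r 0 i = r0 i) \<and>
     (\<forall>t. 0 \<le> t \<and> ereal t < T \<longrightarrow> (\<forall>i\<in>{1..N}.
        r t i > 0 \<and>
        ((\<lambda>s. r s i) has_real_derivative - ext_scalar_curvature \<T> (r t) i * sinh (r t i))
          (at t within {s. 0 \<le> s \<and> ereal s < T})))"

end

theory Submission
  imports Defs
begin

text \<open>Put \<open>y\<^sub>a = coth r\<^sub>a\<close>, let \<open>S\<close> be the sum of the four \<open>y\<^sub>a\<close> of a tetrahedron and let \<open>\<phi>\<^sub>k\<close> be the angle with
  cotangent \<open>(S - 2 y\<^sub>k) / sqrt Q\<close>. The dihedral angle at the edge \<open>ij\<close> is \<open>\<pi> - \<phi>\<^sub>k - \<phi>\<^sub>l\<close>, so the solid angle at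
  \<open>i\<close> is \<open>2\<pi> - 2 (\<phi>\<^sub>j + \<phi>\<^sub>k + \<phi>\<^sub>l)\<close>, and this expression extends continuously to \<open>Q \<le> 0\<close> with the values of the
  extended solid angle. For \<open>Q > 0\<close> the Jacobian of the solid angles with respect to the radii has an explicit
  inverse, from which it is seen to be symmetric and negative semidefinite. Hence along a segment with direction
  \<open>v\<close> the continuous function \<open>\<Sum> \<alpha>\<^sub>i v\<^sub>i\<close> is nonincreasing where \<open>Q > 0\<close> and has only finitely many values where
  \<open>Q \<le> 0\<close>, so it is nonincreasing. The extended curvature is therefore a monotone (though not Lipschitz)
  function of the radii, and Gronwall's inequality for \<open>\<Sum> (r\<^sub>i - r'\<^sub>i)\<^sup>2 / sinh r\<^sub>i\<close> gives uniqueness.\<close>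

section \<open>The Jacobian of the solid angles\<close>

text \<open>By \<open>xi\<close> the vector \<open>(k1, k2, k3, k4)\<close> is orthogonal, with
  respect to the form, to the hyperplane of vectors with first entry \<open>0\<close>, and its own
  value is \<open>k*k1 \<ge> 0\<close>. Subtracting the multiple \<open>l = x1/k1\<close> of it
  moves any point into that hyperplane, so the form is the sum of its value there and
  \<open>l^2*k*k1\<close>.\<close>

lemma quadratic_form_nonneg:
  fixes a b c d m12 m13 m14 m23 m24 m34 :: real
  defines "F \<equiv> \<lambda>x1 x2 x3 x4. a*x1^2 + b*x2^2 + c*x3^2 + d*x4^2 + 2*(m12*x1*x2 + m13*x1*x3 + m14*x1*x4
                   + m23*x2*x3 + m24*x2*x4 + m34*x3*x4)"
  assumes nonneg: "\<And>x2 x3 x4. F 0 x2 x3 x4 \<ge> 0"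
    and xi: "a*k1 + m12*k2 + m13*k3 + m14*k4 = k" "m12*k1 + b*k2 + m23*k3 + m24*k4 = 0"
      "m13*k1 + m23*k2 + c*k3 + m34*k4 = 0" "m14*k1 + m24*k2 + m34*k3 + d*k4 = 0"
    and "k1 > 0" "k \<ge> 0"
  shows "F x1 x2 x3 x4 \<ge> 0"
proof -
  define l where "l = x1 / k1"
  have l: "x1 = l * k1" using \<open>k1 > 0\<close> by (simp add: l_def)
  have "F x1 x2 x3 x4 = F 0 (x2 - l*k2) (x3 - l*k3) (x4 - l*k4) + l^2*k*k1"
  proof -
    \<comment> \<open>The expansion is grouped so that the left-hand sides of \<open>xi\<close>
      occur literally and can be rewritten.\<close>
    have "F (l*k1) x2 x3 x4 = F 0 (x2 - l*k2) (x3 - l*k3) (x4 - l*k4)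
      + 2*l*((l*k1)*(a*k1 + m12*k2 + m13*k3 + m14*k4) + x2*(m12*k1 + b*k2 + m23*k3 + m24*k4)
          + x3*(m13*k1 + m23*k2 + c*k3 + m34*k4) + x4*(m14*k1 + m24*k2 + m34*k3 + d*k4))
      - l^2*(k1*(a*k1 + m12*k2 + m13*k3 + m14*k4) + k2*(m12*k1 + b*k2 + m23*k3 + m24*k4)
          + k3*(m13*k1 + m23*k2 + c*k3 + m34*k4) + k4*(m14*k1 + m24*k2 + m34*k3 + d*k4))"
      unfolding F_def by (simp add: algebra_simps power2_eq_square)
    then show ?thesis
      unfolding l xi by (simp add: power2_eq_square algebra_simps)
  qed
  then show ?thesis using nonneg[of "x2 - l*k2" "x3 - l*k3" "x4 - l*k4"] assms by simp
qed

text \<open>Over a common denominator the sign becomes visible: for positive \<open>b\<close>,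
  \<open>c\<close>, \<open>d\<close> the quotient is nonnegative as soon as \<open>a^2\<close> is at
  most \<open>2\<close> plus the sum of the pairwise products.\<close>

lemma diagonal_part_eq:
  fixes a b c d :: real
  assumes "a > 1"
  shows "(1 + (a*b+a*c+a*d+b*c+b*d+c*d) + a*b*c*d) / (a^2-1) - 1 - b*c*d/a
    = (a*(2 + (a*b+a*c+a*d+b*c+b*d+c*d) - a^2) + b*c*d) / (a*(a^2-1))"
proof -
  define e where "e = a^2 - 1"
  have "a^2 > 1" using assms by simp
  then have ne: "e \<noteq> 0" "a \<noteq> 0" using assms unfolding e_def by linarith+
  have "w/e - 1 - t/a = (w*a - a*e - t*e) / (a*e)" for w t
    using ne by (simp add: field_simps)
  moreover have "(1 + (a*b+a*c+a*d+b*c+b*d+c*d) + a*b*c*d)*a - a*e - (b*c*d)*e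
      = a*(2 + (a*b+a*c+a*d+b*c+b*d+c*d) - a^2) + b*c*d"
    unfolding e_def by algebra
  ultimately show ?thesis unfolding e_def by simp
qed

text \<open>The form is a sum of two squares, \<open>a*b*c*d*(x1/a + x2/b + x3/c + x4/d)^2\<close>
  and \<open>(x1+x2+x3+x4)^2/3\<close>, and a diagonal remainder whose coefficients are nonnegative
  where the variable does not dominate the other three. The alternative \<open>x1 = 0\<close> in the
  hypotheses makes the lemma usable on a coordinate hyperplane when \<open>a\<close> does
  dominate.\<close>

lemma angle_form_nonneg_if_no_dominant:
  fixes a b c d x1 x2 x3 x4 :: real
  defines "W \<equiv> 1 + (a*b+a*c+a*d+b*c+b*d+c*d) + a*b*c*d"
  assumes gt1: "a > 1" "b > 1" "c > 1" "d > 1" 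
  and dom: "x1 = 0 \<or> a \<le> b+c+d" "x2 = 0 \<or> b \<le> a+c+d" "x3 = 0 \<or> c \<le> a+b+d" "x4 = 0 \<or> d \<le> a+b+c"
  shows "(W/(a^2-1) - 2/3)*x1^2 + (W/(b^2-1) - 2/3)*x2^2 + (W/(c^2-1) - 2/3)*x3^2 + (W/(d^2-1) - 2/3)*x4^2
    + 2*((1/3+c*d)*x1*x2 + (1/3+b*d)*x1*x3 + (1/3+b*c)*x1*x4 + (1/3+a*d)*x2*x3 + (1/3+a*c)*x2*x4 + (1/3+a*b)*x3*x4) \<ge> 0"
    (is "?F \<ge> 0")
proof -
  have t: "(W'/(a^2-1) - 1 - b*c*d/a) * x^2 \<ge> 0"
    if "W' = 1 + (a*b+a*c+a*d+b*c+b*d+c*d) + a*b*c*d" "a > 1" "b > 1" "c > 1" "d > 1" "x = 0 \<or> a \<le> b+c+d" for a b c d x W' :: real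
  proof (cases "x = 0")
    case False
    then have "a * a \<le> a * (b+c+d)" using that by (intro mult_left_mono) auto
    moreover have "b*c > 0" "b*d > 0" "c*d > 0" "b*c*d > 0" "a^2 > 1" using that by auto
    ultimately have "2 + (a*b+a*c+a*d+b*c+b*d+c*d) - a^2 \<ge> 0"
      by (simp add: power2_eq_square algebra_simps)
    then have "(a*(2 + (a*b+a*c+a*d+b*c+b*d+c*d) - a^2) + b*c*d) / (a*(a^2-1)) \<ge> 0"
      using that \<open>b*c*d > 0\<close> \<open>a^2 > 1\<close> by (intro divide_nonneg_nonneg add_nonneg_nonneg mult_nonneg_nonneg) auto
    then have "0 \<le> W'/(a^2-1) - 1 - b*c*d/a"
      unfolding diagonal_part_eq[OF that(2), symmetric] that(1) .
    then show ?thesis by simp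
  qed simp
  have n1: "(W/(a^2-1) - 1 - b*c*d/a) * x1^2 \<ge> 0"
    by (rule t[OF W_def[THEN meta_eq_to_obj_eq] gt1(1,2,3,4) dom(1)])
  have n2: "(W/(b^2-1) - 1 - a*c*d/b) * x2^2 \<ge> 0"
    by (rule t[OF _ gt1(2,1,3,4) dom(2)]) (simp add: W_def)
  have n3: "(W/(c^2-1) - 1 - a*b*d/c) * x3^2 \<ge> 0"
    by (rule t[OF _ gt1(3,1,2,4) dom(3)]) (simp add: W_def)
  have n4: "(W/(d^2-1) - 1 - a*b*c/d) * x4^2 \<ge> 0"
    by (rule t[OF _ gt1(4,1,2,3) dom(4)]) (simp add: W_def)
  have n5: "a*b*c*d*(x1/a + x2/b + x3/c + x4/d)^2 \<ge> 0" "(x1+x2+x3+x4)^2/3 \<ge> 0"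
    using gt1 by auto
  have eq: "?F = (W/(a^2-1) - 1 - b*c*d/a) * x1^2 + (W/(b^2-1) - 1 - a*c*d/b) * x2^2
      + (W/(c^2-1) - 1 - a*b*d/c) * x3^2 + (W/(d^2-1) - 1 - a*b*c/d) * x4^2
      + a*b*c*d*(x1/a + x2/b + x3/c + x4/d)^2 + (x1+x2+x3+x4)^2/3"
  proof -
    have ne: "a \<noteq> 0" "b \<noteq> 0" "c \<noteq> 0" "d \<noteq> 0" using gt1 by auto
    have "a*b*c*d*(x1/a + x2/b + x3/c + x4/d)^2 
       = b*c*d/a*x1^2 + a*c*d/b*x2^2 + a*b*d/c*x3^2 + a*b*c/d*x4^2
        + 2*(c*d*x1*x2 + b*d*x1*x3 + b*c*x1*x4 + a*d*x2*x3 + a*c*x2*x4 + a*b*x3*x4)"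
    proof -
      obtain p1 p2 p3 p4 where p: "x1 = a*p1" "x2 = b*p2" "x3 = c*p3" "x4 = d*p4"
        using that[of "x1/a" "x2/b" "x3/c" "x4/d"] ne by simp
      show ?thesis using ne unfolding p by (simp add: power2_eq_square algebra_simps)
    qed
    then show ?thesis by (simp add: algebra_simps power2_eq_square)
  qed
  show ?thesis unfolding eq by (intro add_nonneg_nonneg n1 n2 n3 n4 n5)
qed

text \<open>Here \<open>wi\<close> are velocities of the \<open>yi\<close> and \<open>ui\<close> the resulting velocities of the corner angles, scaled by
  \<open>sqrt Q\<close>. The identity is one row of an explicit inverse of the Jacobian of the solid angles.\<close>

lemma angle_jacobian_inverse_row:
  fixes a b c d w1 w2 w3 w4 u1 u2 u3 u4 :: real
  assumes S: "S = a+b+c+d" and Q: "Q = S^2 - 2*(a^2+b^2+c^2+d^2) + 4"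
    and P: "P = a*w1+b*w2+c*w3+d*w4" and V: "V = w1+w2+w3+w4"
    and W: "W = 1 + (a*b+a*c+a*d+b*c+b*d+c*d) + a*b*c*d"
    and u: "((S-2*a)^2+Q) * u1 = (S-2*a)*(S*V - 2*P) - (V-2*w1)*Q"
    "((S-2*b)^2+Q) * u2 = (S-2*b)*(S*V - 2*P) - (V-2*w2)*Q"
    "((S-2*c)^2+Q) * u3 = (S-2*c)*(S*V - 2*P) - (V-2*w3)*Q"
    "((S-2*d)^2+Q) * u4 = (S-2*d)*(S*V - 2*P) - (V-2*w4)*Q"
    and e: "a^2 - 1 \<noteq> 0"
  shows "(W/(a^2-1) - 2/3)*(u2+u3+u4) + (1/3+c*d)*(u1+u3+u4) + (1/3+b*d)*(u1+u2+u4) + (1/3+b*c)*(u1+u2+u3)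
     = - Q * w1 / (a^2-1)"
proof -
  let ?h1 = "1+b*c+b*d+c*d" let ?h2 = "1+a*c+a*d+c*d"
  let ?h3 = "1+a*b+a*d+b*d" let ?h4 = "1+a*b+a*c+b*c"
  \<comment> \<open>The denominators of the \<open>ui\<close> are polynomials of degree two that
    reappear as factors of the coefficients below.\<close>
  have h: "(S-2*a)^2+Q = 4 * ?h1" "(S-2*b)^2+Q = 4 * ?h2" "(S-2*c)^2+Q = 4 * ?h3" "(S-2*d)^2+Q = 4 * ?h4"
    unfolding Q S by algebra+
  note u' = u[unfolded h]
  \<comment> \<open>This is the row times \<open>a^2-1\<close>, collected by the \<open>ui\<close>;
    each coefficient then splits off the corresponding denominator.\<close>
  have "W*(u2+u3+u4) + (a^2-1)*(u1 + c*d*(u1+u3+u4) + b*d*(u1+u2+u4) + b*c*(u1+u2+u3))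
     = (a^2-1)*(?h1*u1) + (1+a*b)*(?h2*u2) + (1+a*c)*(?h3*u3) + (1+a*d)*(?h4*u4)"
    unfolding W by (simp add: algebra_simps power2_eq_square)
  moreover have "4 * \<dots> = - 4 * Q * w1"
  proof -
    have "4 * ((a^2-1)*(?h1*u1) + (1+a*b)*(?h2*u2) + (1+a*c)*(?h3*u3) + (1+a*d)*(?h4*u4))
      = (a^2-1)*(4*?h1*u1) + (1+a*b)*(4*?h2*u2) + (1+a*c)*(4*?h3*u3) + (1+a*d)*(4*?h4*u4)"
      by (simp add: algebra_simps)
    also have "\<dots> = - 4 * Q * w1"
    proof -
      \<comment> \<open>Put \<open>Z = S*V - 2*P\<close>. With the weights \<open>a^2-1\<close>,
        \<open>1+a*b\<close>, \<open>1+a*c\<close>, \<open>1+a*d\<close> the two weighted sums are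
        \<open>a*Q\<close> and \<open>a*Z + 4*w1\<close>, so the terms with \<open>Z\<close> cancel
        and \<open>- 4*Q*w1\<close> remains.\<close>
      have m1: "(a^2-1)*(S-2*a) + (1+a*b)*(S-2*b) + (1+a*c)*(S-2*c) + (1+a*d)*(S-2*d) = a*Q"
        unfolding S Q by algebra
      have m2: "(a^2-1)*(V-2*w1) + (1+a*b)*(V-2*w2) + (1+a*c)*(V-2*w3) + (1+a*d)*(V-2*w4)
          = a*(S*V - 2*P) + 4*w1"
        unfolding S P V by algebra
      have m3: "e1*(A1*Z - Z1*Q) + e2*(A2*Z - Z2*Q) + e3*(A3*Z - Z3*Q) + e4*(A4*Z - Z4*Q)
          = (e1*A1 + e2*A2 + e3*A3 + e4*A4) * Z - (e1*Z1 + e2*Z2 + e3*Z3 + e4*Z4) * Q"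
        for e1 e2 e3 e4 A1 A2 A3 A4 Z1 Z2 Z3 Z4 Z :: real
        by (simp add: algebra_simps)
      show ?thesis unfolding u' m3 m1 m2 by (simp add: algebra_simps)
    qed
    finally show ?thesis .
  qed
  ultimately have "W*(u2+u3+u4) + (a^2-1)*(u1 + c*d*(u1+u3+u4) + b*d*(u1+u2+u4) + b*c*(u1+u2+u3)) = - Q * w1"
    by simp
  moreover have "x/f + y = z/f" if "x + f*y = z" "f \<noteq> 0" for x y z f :: real
    using that by (auto simp: field_simps)
  ultimately have "W*(u2+u3+u4)/(a^2-1) + (u1 + c*d*(u1+u3+u4) + b*d*(u1+u2+u4) + b*c*(u1+u2+u3)) = - Q * w1 / (a^2-1)"
    using e by blast
  \<comment> \<open>The matrix acts on sums of three of the \<open>ui\<close>. The fractions recover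
    \<open>u1\<close> alone, because the last three sums add up to
    \<open>3*u1 + 2*(u2+u3+u4)\<close>.\<close>
  moreover have "(k - 2/3)*(u2+u3+u4) + (1/3+m2)*(u1+u3+u4) + (1/3+m3)*(u1+u2+u4) + (1/3+m4)*(u1+u2+u3)
     = k*(u2+u3+u4) + (u1 + m2*(u1+u3+u4) + m3*(u1+u2+u4) + m4*(u1+u2+u3))" for k m2 m3 m4 :: real
    by (simp add: field_simps)
  ultimately show ?thesis by simp
qed

text \<open>If \<open>a\<close> dominates, then the diagonal part of the form need not be nonnegative. The columns of the inverse
  matrix are known, however, and the first one splits off the bad direction.\<close>

lemma angle_form_nonneg_if_dominant:
  fixes a b c d x1 x2 x3 x4 :: real
  assumes gt1: "a > 1" "b > 1" "c > 1" "d > 1"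
    and S: "S = a+b+c+d" and Q: "Q = S^2 - 2*(a^2+b^2+c^2+d^2) + 4" and "Q > 0"
    and W: "W = 1 + (a*b+a*c+a*d+b*c+b*d+c*d) + a*b*c*d"
    and dom: "a \<ge> b+c+d"
  shows "(W/(a^2-1) - 2/3)*x1^2 + (W/(b^2-1) - 2/3)*x2^2 + (W/(c^2-1) - 2/3)*x3^2 + (W/(d^2-1) - 2/3)*x4^2
    + 2*((1/3+c*d)*x1*x2 + (1/3+b*d)*x1*x3 + (1/3+b*c)*x1*x4 + (1/3+a*d)*x2*x3 + (1/3+a*c)*x2*x4 + (1/3+a*b)*x3*x4) \<ge> 0"
proof -
  have sq: "a^2 > 1" "b^2 > 1" "c^2 > 1" "d^2 > 1" using gt1 by simp_all
  \<comment> \<open>For \<open>a = coth r1\<close> this is unit speed of \<open>r1\<close> with the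
    other radii fixed. The resulting sums of three \<open>u\<close> values are mapped by the matrix
    to \<open>(Q, 0, 0, 0)\<close>, as \<open>quadratic_form_nonneg\<close> requires.\<close>
  define w1 P where "w1 = -(a^2-1)" and "P = a*w1"
  have N: "(S-2*y)^2 + Q > 0" for y
    using \<open>Q > 0\<close> by (intro add_nonneg_pos) auto
  define u where "u = (\<lambda>y w. ((S-2*y)*(S*w1 - 2*P) - (w1-2*w)*Q) / ((S-2*y)^2+Q))"
  have u: "((S-2*y)^2+Q) * u y w = (S-2*y)*(S*w1 - 2*P) - (w1-2*w)*Q" for y w
    using N[of y] by (simp add: u_def)
  \<comment> \<open>Dominance of \<open>a\<close> says \<open>2*a - S \<ge> 0\<close>, so the
    numerator is a positive multiple of a nonnegative term plus \<open>Q\<close>.\<close>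
  have pos: "u y 0 > 0" if "S - 2*y > 0" for y
  proof -
    have "(S-2*y)*(S*w1 - 2*P) - (w1-2*0)*Q = (a^2-1) * ((S-2*y)*(2*a-S) + Q)"
      unfolding w1_def P_def by (simp add: algebra_simps)
    also have "\<dots> > 0"
      using that dom S \<open>Q > 0\<close> sq by (intro mult_pos_pos add_nonneg_pos mult_nonneg_nonneg) auto
    finally show ?thesis using N[of y] by (simp add: u_def)
  qed
  have sq0: "a^2-1 \<noteq> 0" "b^2-1 \<noteq> 0" "c^2-1 \<noteq> 0" "d^2-1 \<noteq> 0" using sq by auto
  have P: "P = a*w1+b*0+c*0+d*0" "P = b*0+a*w1+c*0+d*0" "P = c*0+a*w1+b*0+d*0" "P = d*0+a*w1+b*0+c*0"
    by (auto simp: P_def)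
  have V: "w1 = w1+0+0+0" "w1 = 0+w1+0+0" by auto
  have S': "S = b+a+c+d" "S = c+a+b+d" "S = d+a+b+c" using S by auto
  have Q': "Q = S^2 - 2*(b^2+a^2+c^2+d^2) + 4" "Q = S^2 - 2*(c^2+a^2+b^2+d^2) + 4"
    "Q = S^2 - 2*(d^2+a^2+b^2+c^2) + 4" using Q by auto
  have W': "W = 1 + (b*a+b*c+b*d+a*c+a*d+c*d) + b*a*c*d" "W = 1 + (c*a+c*b+c*d+a*b+a*d+b*d) + c*a*b*d"
    "W = 1 + (d*a+d*b+d*c+a*b+a*c+b*c) + d*a*b*c" using W by auto
  have w1: "- Q * w1 / (a^2-1) = Q" 
  proof -
    have "- Q * (- e) / e = Q" if "e \<noteq> 0" for e using that by simp
    then show ?thesis unfolding w1_def using sq0 by blast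
  qed
  have zero: "- Q * 0 / x = 0" for x by simp
  note r1 = angle_jacobian_inverse_row[OF S Q P(1) V(1) W u u u u sq0(1), unfolded w1]
  note r2 = angle_jacobian_inverse_row[OF S'(1) Q'(1) P(2) V(2) W'(1) u u u u sq0(2), unfolded zero]
  note r3 = angle_jacobian_inverse_row[OF S'(2) Q'(2) P(3) V(2) W'(2) u u u u sq0(3), unfolded zero]
  note r4 = angle_jacobian_inverse_row[OF S'(3) Q'(3) P(4) V(2) W'(3) u u u u sq0(4), unfolded zero]
  show ?thesis
  proof (rule quadratic_form_nonneg)
    show "0 < u b 0 + u c 0 + u d 0"
      using pos[of b] pos[of c] pos[of d] dom S gt1 by linarith
    show "(W/(a^2-1) - 2/3)*(u b 0 + u c 0 + u d 0) + (1/3+c*d)*(u a w1 + u c 0 + u d 0)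
       + (1/3+b*d)*(u a w1 + u b 0 + u d 0) + (1/3+b*c)*(u a w1 + u b 0 + u c 0) = Q"
      by (rule r1)
    show "(1/3+c*d)*(u b 0 + u c 0 + u d 0) + (W/(b^2-1) - 2/3)*(u a w1 + u c 0 + u d 0)
       + (1/3+a*d)*(u a w1 + u b 0 + u d 0) + (1/3+a*c)*(u a w1 + u b 0 + u c 0) = 0"
      using r2 by (simp only: ac_simps)
    show "(1/3+b*d)*(u b 0 + u c 0 + u d 0) + (1/3+a*d)*(u a w1 + u c 0 + u d 0)
       + (W/(c^2-1) - 2/3)*(u a w1 + u b 0 + u d 0) + (1/3+a*b)*(u a w1 + u b 0 + u c 0) = 0"
      using r3 by (simp only: ac_simps)
    show "(1/3+b*c)*(u b 0 + u c 0 + u d 0) + (1/3+a*c)*(u a w1 + u c 0 + u d 0)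
       + (1/3+a*b)*(u a w1 + u b 0 + u d 0) + (W/(d^2-1) - 2/3)*(u a w1 + u b 0 + u c 0) = 0"
      using r4 by (simp only: ac_simps)
    \<comment> \<open>On the hyperplane the first hypothesis holds by \<open>x1 = 0\<close>, and
      none of \<open>b\<close>, \<open>c\<close>, \<open>d\<close> can dominate because
      \<open>a\<close> does.\<close>
    show "0 \<le> (W/(a^2-1) - 2/3)*0^2 + (W/(b^2-1) - 2/3)*y2^2 + (W/(c^2-1) - 2/3)*y3^2 + (W/(d^2-1) - 2/3)*y4^2
      + 2*((1/3+c*d)*0*y2 + (1/3+b*d)*0*y3 + (1/3+b*c)*0*y4 + (1/3+a*d)*y2*y3 + (1/3+a*c)*y2*y4 + (1/3+a*b)*y3*y4)"
      for y2 y3 y4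
      unfolding W using dom gt1 by (intro angle_form_nonneg_if_no_dominant) auto
  qed (use \<open>Q > 0\<close> in simp)
qed

lemma angle_form_nonneg:
  fixes a b c d x1 x2 x3 x4 :: real
  assumes gt1: "a > 1" "b > 1" "c > 1" "d > 1"
    and S: "S = a+b+c+d" and Q: "Q = S^2 - 2*(a^2+b^2+c^2+d^2) + 4" and "Q > 0"
    and W: "W = 1 + (a*b+a*c+a*d+b*c+b*d+c*d) + a*b*c*d"
  shows "(W/(a^2-1) - 2/3)*x1^2 + (W/(b^2-1) - 2/3)*x2^2 + (W/(c^2-1) - 2/3)*x3^2 + (W/(d^2-1) - 2/3)*x4^2
    + 2*((1/3+c*d)*x1*x2 + (1/3+b*d)*x1*x3 + (1/3+b*c)*x1*x4 + (1/3+a*d)*x2*x3 + (1/3+a*c)*x2*x4 + (1/3+a*b)*x3*x4) \<ge> 0"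
    (is "?F \<ge> 0")
proof -
  consider "a \<ge> b+c+d" | "b \<ge> a+c+d" | "c \<ge> a+b+d" | "d \<ge> a+b+c"
    | "a \<le> b+c+d" "b \<le> a+c+d" "c \<le> a+b+d" "d \<le> a+b+c" by linarith
  then show ?thesis
  proof cases
    case 1
    then show ?thesis using angle_form_nonneg_if_dominant[OF gt1 S Q \<open>Q > 0\<close> W] by blast
  next
    case 2
    show ?thesis
      using angle_form_nonneg_if_dominant[OF gt1(2,1,3,4), of S Q W x2 x1 x3 x4] 2 S Q \<open>Q > 0\<close> W
      by (simp add: algebra_simps)
  next
    case 3
    show ?thesis
      using angle_form_nonneg_if_dominant[OF gt1(3,1,2,4), of S Q W x3 x1 x2 x4] 3 S Q \<open>Q > 0\<close> W
      by (simp add: algebra_simps)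
  next
    case 4
    show ?thesis
      using angle_form_nonneg_if_dominant[OF gt1(4,1,2,3), of S Q W x4 x1 x2 x3] 4 S Q \<open>Q > 0\<close> W
      by (simp add: algebra_simps)
  next
    case 5
    then show ?thesis unfolding W using gt1 by (intro angle_form_nonneg_if_no_dominant) auto
  qed
qed

text \<open>The \<open>ti\<close> are velocities of radii, so that \<open>wi\<close> is the velocity
  of their hyperbolic cotangents. By the row identities the matrix maps the vector \<open>x\<close>
  of sums of three \<open>ui\<close> to \<open>Q\<close> times the vector of the \<open>ti\<close>.
  Hence \<open>Q\<close> times the expression is the value of the nonnegative form at
  \<open>x\<close>.\<close>

lemma angle_derivative_form_nonneg:
  fixes a b c d w1 w2 w3 w4 u1 u2 u3 u4 :: real
  assumes gt1: "a > 1" "b > 1" "c > 1" "d > 1"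
    and S: "S = a+b+c+d" and Q: "Q = S^2 - 2*(a^2+b^2+c^2+d^2) + 4" and "Q > 0"
    and P: "P = a*w1+b*w2+c*w3+d*w4" and V: "V = w1+w2+w3+w4"
    and u: "((S-2*a)^2+Q) * u1 = (S-2*a)*(S*V - 2*P) - (V-2*w1)*Q"
    "((S-2*b)^2+Q) * u2 = (S-2*b)*(S*V - 2*P) - (V-2*w2)*Q"
    "((S-2*c)^2+Q) * u3 = (S-2*c)*(S*V - 2*P) - (V-2*w3)*Q"
    "((S-2*d)^2+Q) * u4 = (S-2*d)*(S*V - 2*P) - (V-2*w4)*Q"
    and v: "w1 = - (a^2-1) * t1" "w2 = - (b^2-1) * t2" "w3 = - (c^2-1) * t3" "w4 = - (d^2-1) * t4"
  shows "u1*(t2+t3+t4) + u2*(t1+t3+t4) + u3*(t1+t2+t4) + u4*(t1+t2+t3) \<ge> 0" (is "?T \<ge> 0")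
proof -
  have "a^2 > 1" "b^2 > 1" "c^2 > 1" "d^2 > 1" using gt1 by simp_all
  then have sq: "a^2-1 \<noteq> 0" "b^2-1 \<noteq> 0" "c^2-1 \<noteq> 0" "d^2-1 \<noteq> 0" by auto
  define W where W: "W = 1 + (a*b+a*c+a*d+b*c+b*d+c*d) + a*b*c*d"
  have S': "S = b+a+c+d" "S = c+a+b+d" "S = d+a+b+c" using S by auto
  have Q': "Q = S^2 - 2*(b^2+a^2+c^2+d^2) + 4" "Q = S^2 - 2*(c^2+a^2+b^2+d^2) + 4"
    "Q = S^2 - 2*(d^2+a^2+b^2+c^2) + 4" using Q by auto
  have P': "P = b*w2+a*w1+c*w3+d*w4" "P = c*w3+a*w1+b*w2+d*w4" "P = d*w4+a*w1+b*w2+c*w3" using P by auto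
  have V': "V = w2+w1+w3+w4" "V = w3+w1+w2+w4" "V = w4+w1+w2+w3" using V by auto
  have W': "W = 1 + (b*a+b*c+b*d+a*c+a*d+c*d) + b*a*c*d" "W = 1 + (c*a+c*b+c*d+a*b+a*d+b*d) + c*a*b*d"
    "W = 1 + (d*a+d*b+d*c+a*b+a*c+b*c) + d*a*b*c" using W by auto
  have cancel: "- Q * w / e = Q * t" if "w = - e * t" "e \<noteq> 0" for w e t :: real
    using that by simp
  note r1 = angle_jacobian_inverse_row[OF S Q P V W u sq(1), unfolded cancel[OF v(1) sq(1)]]
  note r2 = angle_jacobian_inverse_row[OF S'(1) Q'(1) P'(1) V'(1) W'(1) u(2,1,3,4) sq(2), unfolded cancel[OF v(2) sq(2)]]
  note r3 = angle_jacobian_inverse_row[OF S'(2) Q'(2) P'(2) V'(2) W'(2) u(3,1,2,4) sq(3), unfolded cancel[OF v(3) sq(3)]]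
  note r4 = angle_jacobian_inverse_row[OF S'(3) Q'(3) P'(3) V'(3) W'(3) u(4,1,2,3) sq(4), unfolded cancel[OF v(4) sq(4)]]
  let ?x1 = "u2+u3+u4" and ?x2 = "u1+u3+u4" and ?x3 = "u1+u2+u4" and ?x4 = "u1+u2+u3"
  have "Q * ?T = ?x1*(Q*t1) + ?x2*(Q*t2) + ?x3*(Q*t3) + ?x4*(Q*t4)" by (simp add: algebra_simps)
  also have "\<dots> = (W/(a^2-1) - 2/3)*?x1^2 + (W/(b^2-1) - 2/3)*?x2^2 + (W/(c^2-1) - 2/3)*?x3^2 + (W/(d^2-1) - 2/3)*?x4^2
    + 2*((1/3+c*d)*?x1*?x2 + (1/3+b*d)*?x1*?x3 + (1/3+b*c)*?x1*?x4 + (1/3+a*d)*?x2*?x3 + (1/3+a*c)*?x2*?x4 + (1/3+a*b)*?x3*?x4)"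
    (is "_ = ?F")
  proof -
    have alg: "x1*(A1*x1+m12*x2+m13*x3+m14*x4) + x2*(A2*x2+m12*x1+m23*x3+m24*x4)
       + x3*(A3*x3+m13*x1+m23*x2+m34*x4) + x4*(A4*x4+m14*x1+m24*x2+m34*x3)
      = A1*x1^2 + A2*x2^2 + A3*x3^2 + A4*x4^2 + 2*(m12*x1*x2+m13*x1*x3+m14*x1*x4+m23*x2*x3+m24*x2*x4+m34*x3*x4)"
      for x1 x2 x3 x4 A1 A2 A3 A4 m12 m13 m14 m23 m24 m34 :: real
      by (simp add: algebra_simps power2_eq_square)
    show ?thesis
      unfolding alg[symmetric] r1[symmetric] r2[symmetric] r3[symmetric] r4[symmetric]
      by (simp add: ac_simps)
  qed
  also have "\<dots> \<ge> 0" by (rule angle_form_nonneg[OF gt1 S Q \<open>Q > 0\<close> W])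
  finally show ?thesis using \<open>Q > 0\<close> by (simp add: zero_le_mult_iff)
qed

section \<open>The solid angles of a ball packing tetrahedron\<close>

text \<open>The two angles on the right have cotangents \<open>A/z\<close> and \<open>B/z\<close>,
  and the addition theorem gives the cosine of the right-hand side. The hypothesis
  \<open>A + B > 0\<close> keeps the sum of the two angles below \<open>pi\<close>, so that
  \<open>arccos\<close> returns the right-hand side itself.\<close>

lemma arccos_add_complement:
  fixes A B z :: real
  assumes z: "z > 0" and "A + B > 0"
  shows "arccos ((z^2 - A*B) / (sqrt (A^2+z^2) * sqrt (B^2+z^2)))
    = pi - arccos (A / sqrt (A^2+z^2)) - arccos (B / sqrt (B^2+z^2))"
proof -
  have pos: "X^2 + z^2 > 0" for X :: real using z by (simp add: add_nonneg_pos)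
  define f where "f = (\<lambda>X. arccos (X / sqrt (X^2+z^2)))"
  have bd: "\<bar>X / sqrt (X^2+z^2)\<bar> < 1" for X
  proof -
    have "\<bar>X\<bar> < sqrt (X^2+z^2)" using z by (intro real_less_rsqrt) auto
    then show ?thesis using pos[of X] by (simp add: abs_divide)
  qed
  have cosf: "cos (f X) = X / sqrt (X^2+z^2)" for X
    using bd[of X] by (simp add: f_def cos_arccos_abs)
  have sinf: "sin (f X) = z / sqrt (X^2+z^2)" for X
  proof -
    have "sin (f X) = sqrt (1 - (X / sqrt (X^2+z^2))^2)"
      using bd[of X] by (simp add: f_def sin_arccos_abs)
    also have "1 - (X / sqrt (X^2+z^2))^2 = (z / sqrt (X^2+z^2))^2"
      using pos[of X] z by (simp add: power_divide field_simps)
    finally show ?thesis using z pos[of X] by simp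
  qed
  have range: "0 < f X" "f X < pi" for X
    using arccos_lt_bounded[of "X / sqrt (X^2+z^2)"] bd[of X] unfolding f_def abs_less_iff by linarith+
  have mono: "f X < f Y" if "Y < X" for X Y
  proof -
    have "sin (f Y - f X) = z * (X - Y) / (sqrt (X^2+z^2) * sqrt (Y^2+z^2))"
      proof -
      have "z/q * (X/p) - Y/q * (z/p) = z * (X-Y) / (p*q)" for p q
        by (simp add: diff_divide_distrib algebra_simps)
      then show ?thesis unfolding sin_diff cosf sinf .
    qed
    also have "\<dots> > 0" using that z pos by (intro divide_pos_pos mult_pos_pos) auto
    finally have "0 < sin (f Y - f X)" .
    moreover have "sin (f Y - f X) \<le> 0" if "f Y \<le> f X"
      using sin_ge_zero[of "f X - f Y"] that range[of X] range[of Y] sin_minus[of "f X - f Y"] by simp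
    ultimately show ?thesis by linarith
  qed
  \<comment> \<open>Since \<open>f\<close> is strictly decreasing, \<open>A > - B\<close> now yields
    \<open>f A + f B < pi\<close>.\<close>
  have "f (- B) = pi - f B"
    using bd[of B] unfolding f_def abs_less_iff by (simp add: arccos_minus)
  then have "f A + f B < pi" using mono[of "-B" A] assms by simp
  then have "arccos (cos (pi - f A - f B)) = pi - f A - f B"
    using range[of A] range[of B] by (intro arccos_cos) auto
  moreover have "cos (pi - f A - f B) = (z^2 - A*B) / (sqrt (A^2+z^2) * sqrt (B^2+z^2))"
  proof -
    have "- (A/p * (B/q) - z/p * (z/q)) = (z^2 - A*B) / (p*q)" for p q
      by (simp add: diff_divide_distrib power2_eq_square)
    moreover have "cos (pi - f A - f B) = - cos (f A + f B)"
      by (metis cos_pi_minus diff_diff_eq)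
    ultimately show ?thesis unfolding cos_add cosf sinf by simp
  qed
  ultimately show ?thesis by (simp add: f_def)
qed

section \<open>Lorentz products, projections and hyperbolic distance\<close>

lemma lorentz_bilinear:
  "lorentz (x + y) z = lorentz x z + lorentz y z" "lorentz z (x + y) = lorentz z x + lorentz z y"
  "lorentz (x - y) z = lorentz x z - lorentz y z" "lorentz z (x - y) = lorentz z x - lorentz z y"
  "lorentz (c *\<^sub>R x) z = c * lorentz x z" "lorentz z (c *\<^sub>R x) = c * lorentz z x"
  by (auto simp: lorentz_def algebra_simps inner_simps)

lemma lorentz_commute: "lorentz x y = lorentz y x"
  by (simp add: lorentz_def inner_commute mult.commute)

lemma lorentz_perp_perp:
  assumes "lorentz e e \<noteq> 0"
  shows "lorentz (lorentz_perp e x) (lorentz_perp e y) = lorentz x y - lorentz e x * lorentz e y / lorentz e e"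
  using assms lorentz_commute[of x e] lorentz_commute[of y e]
  by (simp add: lorentz_perp_def lorentz_bilinear field_simps)

text \<open>The reversed Cauchy-Schwarz inequality for time-like vectors; it places
  \<open>- lorentz p q\<close> in the range on which \<open>arcosh\<close> inverts
  \<open>cosh\<close>.\<close>

lemma hyperbolic_space_lorentz_le:
  assumes "p \<in> hyperbolic_space" "q \<in> hyperbolic_space"
  shows "- lorentz p q \<ge> 1"
proof -
  have p: "(snd p)^2 = 1 + (norm (fst p))^2" "snd p > 0" and q: "(snd q)^2 = 1 + (norm (fst q))^2" "snd q > 0"
    using assms by (auto simp: hyperbolic_space_def lorentz_def power2_eq_square dot_square_norm)
  have "(1 + norm (fst p) * norm (fst q))^2 \<le> (snd p * snd q)^2"
  proof -
    have "(snd p * snd q)^2 = (1 + norm (fst p) * norm (fst q))^2 + (norm (fst p) - norm (fst q))^2"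
    proof -
      have "(1 + x^2) * (1 + y^2) = (1 + x*y)^2 + (x - y)^2" for x y :: real by algebra
      then show ?thesis by (simp add: power_mult_distrib p(1) q(1))
    qed
    also have "\<dots> \<ge> (1 + norm (fst p) * norm (fst q))^2" by simp
    finally show ?thesis .
  qed
  then have "1 + norm (fst p) * norm (fst q) \<le> snd p * snd q"
  proof (rule power2_le_imp_le)
    show "0 \<le> snd p * snd q" using p(2) q(2) by simp
  qed
  moreover have "fst p \<bullet> fst q \<le> norm (fst p) * norm (fst q)"
    using Cauchy_Schwarz_ineq2[of "fst p" "fst q"] by simp
  ultimately show ?thesis by (simp add: lorentz_def)
qed

lemma hyp_dist_eq_iff:
  assumes "p \<in> hyperbolic_space" "q \<in> hyperbolic_space" "l \<ge> 0"
  shows "hyp_dist p q = l \<longleftrightarrow> lorentz p q = - cosh l"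
proof
  assume "hyp_dist p q = l"
  then have "cosh l = cosh (arcosh (- lorentz p q))" by (simp add: hyp_dist_def)
  also have "\<dots> = - lorentz p q" using hyperbolic_space_lorentz_le assms by (intro cosh_arcosh_real) auto
  finally show "lorentz p q = - cosh l" by simp
next
  assume "lorentz p q = - cosh l"
  then show "hyp_dist p q = l" using assms by (simp add: hyp_dist_def arcosh_cosh_real)
qed

section \<open>Hyperbolic cotangents and dihedral angles\<close>

lemma coth_gt_1: "x > 0 \<Longrightarrow> coth x > 1"
  by (simp add: coth_def sinh_less_cosh_real)

lemma sinh_sq_coth:
  assumes "x > 0"
  shows "(sinh x)^2 * ((coth x)^2 - 1) = 1"
  using assms hyperbolic_pythagoras[of x] by (simp add: coth_def power_divide right_diff_distrib)

lemma cosh_add_coth: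
  assumes "x > 0" "y > 0"
  shows "cosh (x + y) = sinh x * sinh y * (1 + coth x * coth y)"
  using assms by (simp add: coth_def cosh_add field_simps)

lemma abs_divide_sqrt_le_1:
  fixes t m :: real
  assumes "m \<ge> 0"
  shows "\<bar>t / sqrt (t^2 + m)\<bar> \<le> 1"
proof -
  have "\<bar>t\<bar> \<le> sqrt (t^2 + m)" using assms by (intro real_le_rsqrt) auto
  then show ?thesis by (cases "t = 0") (auto simp: divide_le_eq)
qed

text \<open>For \<open>Q > 0\<close> this is the angle with cotangent \<open>(S - 2 y) / sqrt Q\<close>; the form with \<open>arccos\<close> is continuous
  up to \<open>Q \<le> 0\<close>, where only the values \<open>0\<close> and \<open>pi\<close> occur.\<close>

definition corner_angle :: "real \<Rightarrow> real \<Rightarrow> real \<Rightarrow> real" where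
  "corner_angle S Q y = arccos ((S - 2*y) / sqrt ((S - 2*y)^2 + max 0 Q))"

text \<open>The parameters \<open>xi\<close> and \<open>yi\<close> stand for \<open>sinh ri\<close> and \<open>coth ri\<close>, so that the inner products
  prescribed below are the numbers \<open>- cosh (ri + rj)\<close>.\<close>

lemma dihedral_angle_packing:
  fixes p q a b :: minkowski and x1 x2 x3 x4 y1 y2 y3 y4 :: real
  assumes s: "x1 > 0" "x2 > 0" "x3 > 0" "x4 > 0" and y: "y1 > 1" "y2 > 1" "y3 > 1" "y4 > 1"
    and sy: "x1^2 * (y1^2 - 1) = 1" "x2^2 * (y2^2 - 1) = 1" "x3^2 * (y3^2 - 1) = 1" "x4^2 * (y4^2 - 1) = 1"
    and S: "S = y1+y2+y3+y4" and Q: "Q = S^2 - 2*(y1^2+y2^2+y3^2+y4^2) + 4" and "Q > 0"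
    and sq: "lorentz p p = -1" "lorentz q q = -1" "lorentz a a = -1" "lorentz b b = -1"
    and pr: "lorentz p q = - (x1*x2*(1+y1*y2))" "lorentz p a = - (x1*x3*(1+y1*y3))"
      "lorentz p b = - (x1*x4*(1+y1*y4))" "lorentz q a = - (x2*x3*(1+y2*y3))"
      "lorentz q b = - (x2*x4*(1+y2*y4))" "lorentz a b = - (x3*x4*(1+y3*y4))"
  shows "dihedral_angle p q a b = pi - corner_angle S Q y3 - corner_angle S Q y4"
proof -
  define e where "e = lorentz_perp p q"
  define \<kappa> where "\<kappa> = (\<lambda>y z. 2 + y1*y + y1*z + y*z - y1^2)"
  define k where "k = x1^2"
  have k: "k * (y1^2 - 1) = 1" "k > 0" using sy s by (auto simp: k_def)
  have p0: "lorentz p p \<noteq> 0" using sq by simp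
  have gram: "lorentz (lorentz_perp p u) (lorentz_perp p v) = k*t1*t2*\<kappa> z1 z2"
    if "lorentz p u = - (x1*t1*(1+y1*z1))" "lorentz p v = - (x1*t2*(1+y1*z2))" "lorentz u v = - (t1*t2*(1+z1*z2))"
    for u v t1 t2 z1 z2
  proof -
    have "lorentz (lorentz_perp p u) (lorentz_perp p v) = t1*t2*(k*((1+y1*z1)*(1+y1*z2)) - (1+z1*z2))"
      unfolding lorentz_perp_perp[OF p0] that sq k_def by (simp add: algebra_simps power2_eq_square)
    also have "k*((1+y1*z1)*(1+y1*z2)) - (1+z1*z2) = k*\<kappa> z1 z2 + (k*(y1^2-1) - 1)*(1+z1*z2)"
      unfolding \<kappa>_def by algebra
    finally show ?thesis using k by simp
  qed
  \<comment> \<open>The case \<open>u = v\<close> is not an instance of \<open>gram\<close>: here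
    the product is \<open>-1\<close>, which differs from \<open>- (t*t*(1+z*z))\<close>.\<close>
  have diag: "lorentz (lorentz_perp p u) (lorentz_perp p u) = k*t^2*(y1+z)^2"
    if "lorentz p u = - (x1*t*(1+y1*z))" "lorentz u u = - 1" "t^2*(z^2-1) = 1" for u t z
  proof -
    have "lorentz (lorentz_perp p u) (lorentz_perp p u) = k*t^2*(1+y1*z)^2 - 1"
      unfolding lorentz_perp_perp[OF p0] that(1,2) sq k_def by (simp add: algebra_simps power2_eq_square)
    also have "\<dots> = k*t^2*(y1+z)^2 + (k*(y1^2-1))*(t^2*(z^2-1)) - 1" by algebra
    finally show ?thesis using k that by simp
  qed
  have ee: "lorentz e e = k*x2^2*(y1+y2)^2"
    unfolding e_def by (rule diag[OF pr(1) sq(2) sy(2)])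
  have "y1 + y2 > 0" using y by simp
  then have e0: "lorentz e e > 0" unfolding ee using k s by simp
  define X Y where "X = lorentz_perp e (lorentz_perp p a)" and "Y = lorentz_perp e (lorentz_perp p b)"
  have ea: "lorentz e (lorentz_perp p a) = k*x2*x3*\<kappa> y2 y3" unfolding e_def by (rule gram) (use pr in auto)
  have eb: "lorentz e (lorentz_perp p b) = k*x2*x4*\<kappa> y2 y4" unfolding e_def by (rule gram) (use pr in auto)
  have ab: "lorentz (lorentz_perp p a) (lorentz_perp p b) = k*x3*x4*\<kappa> y3 y4" by (rule gram) (use pr in auto)
  note aa = diag[OF pr(2) sq(3) sy(3), unfolded power2_eq_square[of x3] mult.assoc[symmetric]]
  note bb = diag[OF pr(3) sq(4) sy(4), unfolded power2_eq_square[of x4] mult.assoc[symmetric]]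
  have e0': "lorentz e e \<noteq> 0" using e0 by simp
  define A B where "A = S - 2*y3" and "B = S - 2*y4"
  \<comment> \<open>Projecting away from \<open>e\<close> gives all three products the shape
    \<open>t1*t2/(y1+y2)^2 * D\<close>, and the prefactors cancel in the cosine. The factor
    \<open>y1^2-1\<close> produced by each polynomial identity is absorbed by
    \<open>k\<close>.\<close>
  have proj: "k*t1*t2*m - (k*x2*t1*m1)*(k*x2*t2*m2)/(k*x2^2*(y1+y2)^2) = t1*t2/(y1+y2)^2 * D"
    if "k*(m*(y1+y2)^2 - m1*m2) = D" for t1 t2 m m1 m2 D
  proof -
    have "k*t1*t2*m - (k*x2*t1*m1)*(k*x2*t2*m2)/(k*x2^2*(y1+y2)^2)
        = k*t1*t2*m - k*t1*t2*m1*m2/(y1+y2)^2"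
      using k s by (simp add: power2_eq_square)
    also have "\<dots> = t1*t2/(y1+y2)^2 * (k*(m*(y1+y2)^2 - m1*m2))"
      using \<open>y1+y2 > 0\<close> by (simp add: field_simps)
    finally show ?thesis using that by simp
  qed
  have XY: "lorentz X Y = x3*x4/(y1+y2)^2 * (Q - A*B)"
  proof -
    have "\<kappa> y3 y4 * (y1+y2)^2 - \<kappa> y2 y3 * \<kappa> y2 y4 = (y1^2-1) * (Q - A*B)"
      unfolding \<kappa>_def A_def B_def Q S by algebra
    then have "k*(\<kappa> y3 y4 * (y1+y2)^2 - \<kappa> y2 y3 * \<kappa> y2 y4) = Q - A*B"
      using k by (metis mult.assoc mult_1)
    then show ?thesis
      unfolding X_def Y_def lorentz_perp_perp[OF e0'] ab ea eb ee by (rule proj)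
  qed
  have XX: "lorentz X X = x3^2/(y1+y2)^2 * (B^2 + Q)"
  proof -
    have "(y1+y3)^2 * (y1+y2)^2 - \<kappa> y2 y3 * \<kappa> y2 y3 = (y1^2-1) * (B^2 + Q)"
      unfolding \<kappa>_def B_def Q S by algebra
    then have "k*((y1+y3)^2 * (y1+y2)^2 - \<kappa> y2 y3 * \<kappa> y2 y3) = B^2 + Q"
      using k by (metis mult.assoc mult_1)
    then show ?thesis
      unfolding X_def lorentz_perp_perp[OF e0'] aa ea ee power2_eq_square[of x3] by (rule proj)
  qed
  have YY: "lorentz Y Y = x4^2/(y1+y2)^2 * (A^2 + Q)"
  proof -
    have "(y1+y4)^2 * (y1+y2)^2 - \<kappa> y2 y4 * \<kappa> y2 y4 = (y1^2-1) * (A^2 + Q)"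
      unfolding \<kappa>_def A_def Q S by algebra
    then have "k*((y1+y4)^2 * (y1+y2)^2 - \<kappa> y2 y4 * \<kappa> y2 y4) = A^2 + Q"
      using k by (metis mult.assoc mult_1)
    then show ?thesis
      unfolding Y_def lorentz_perp_perp[OF e0'] bb eb ee power2_eq_square[of x4] by (rule proj)
  qed
  have "lorentz X Y / (sqrt (lorentz X X) * sqrt (lorentz Y Y))
     = (Q - A*B) / (sqrt (A^2+Q) * sqrt (B^2+Q))"
  proof -
    have "sqrt (lorentz X X) = x3/(y1+y2) * sqrt (B^2+Q)" "sqrt (lorentz Y Y) = x4/(y1+y2) * sqrt (A^2+Q)"
      unfolding XX YY using s \<open>y1+y2 > 0\<close> by (simp_all add: real_sqrt_mult real_sqrt_divide)
    moreover have "x3*x4/g^2 * D / (x3/g*E * (x4/g*F)) = D / (F*E)" if "g > 0" for g D E F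
      using that s by (simp add: power2_eq_square divide_simps)
    ultimately show ?thesis unfolding XY using \<open>y1+y2 > 0\<close> by simp
  qed
  also have "arccos \<dots> = pi - arccos (A / sqrt (A^2+Q)) - arccos (B / sqrt (B^2+Q))"
    using arccos_add_complement[of "sqrt Q" A B] \<open>Q > 0\<close> y by (simp add: A_def B_def S)
  finally show ?thesis
    using \<open>Q > 0\<close>
    by (simp add: dihedral_angle_def Let_def lorentz_angle_def e_def[symmetric] X_def[symmetric] Y_def[symmetric]
        corner_angle_def A_def B_def)
qed

lemma ball_packing_tetrahedron_iff:
  assumes "r1 > 0" "r2 > 0" "r3 > 0" "r4 > 0"
  shows "ball_packing_tetrahedron r1 r2 r3 r4 p q a b \<longleftrightarrow>
    nondegenerate_tetrahedron p q a b \<and>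
    lorentz p q = - (sinh r1 * sinh r2 * (1 + coth r1 * coth r2)) \<and>
    lorentz p a = - (sinh r1 * sinh r3 * (1 + coth r1 * coth r3)) \<and>
    lorentz p b = - (sinh r1 * sinh r4 * (1 + coth r1 * coth r4)) \<and>
    lorentz q a = - (sinh r2 * sinh r3 * (1 + coth r2 * coth r3)) \<and>
    lorentz q b = - (sinh r2 * sinh r4 * (1 + coth r2 * coth r4)) \<and>
    lorentz a b = - (sinh r3 * sinh r4 * (1 + coth r3 * coth r4))"
proof (cases "{p, q, a, b} \<subseteq> hyperbolic_space")
  case True
  then have "p \<in> hyperbolic_space" "q \<in> hyperbolic_space" "a \<in> hyperbolic_space" "b \<in> hyperbolic_space"
    by auto
  then show ?thesis
    using assms unfolding ball_packing_tetrahedron_def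
    by (simp add: hyp_dist_eq_iff cosh_add_coth)
qed (auto simp: ball_packing_tetrahedron_def nondegenerate_tetrahedron_def)

text \<open>The dihedral angles at the three edges through \<open>p\<close> are instances of one
  formula with permuted vertices. Each corner angle occurs in two of them, and
  \<open>3*pi - pi\<close> leaves \<open>2*pi\<close>.\<close>

lemma tetrahedron_solid_angle_packing:
  assumes r: "r1 > 0" "r2 > 0" "r3 > 0" "r4 > 0"
    and y: "y1 = coth r1" "y2 = coth r2" "y3 = coth r3" "y4 = coth r4"
    and S: "S = y1+y2+y3+y4" and Q: "Q = S^2 - 2*(y1^2+y2^2+y3^2+y4^2) + 4" and "Q > 0"
    and pack: "ball_packing_tetrahedron r1 r2 r3 r4 p q a b"
  shows "tetrahedron_solid_angle p q a b = 2*pi - 2*(corner_angle S Q y2 + corner_angle S Q y3 + corner_angle S Q y4)"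
proof -
  have S': "S = y1+y3+y2+y4" "S = y1+y4+y2+y3" using S by auto
  have Q': "Q = S^2 - 2*(y1^2+y3^2+y2^2+y4^2) + 4" "Q = S^2 - 2*(y1^2+y4^2+y2^2+y3^2) + 4"
    using Q by auto
  have x: "sinh r1 > 0" "sinh r2 > 0" "sinh r3 > 0" "sinh r4 > 0" using r by auto
  have gt1: "y1 > 1" "y2 > 1" "y3 > 1" "y4 > 1" using r coth_gt_1 y by auto
  have xy: "(sinh r1)^2 * (y1^2-1) = 1" "(sinh r2)^2 * (y2^2-1) = 1" "(sinh r3)^2 * (y3^2-1) = 1"
    "(sinh r4)^2 * (y4^2-1) = 1"
    using r sinh_sq_coth y by auto
  have nd: "nondegenerate_tetrahedron p q a b"
    and g: "lorentz p q = - (sinh r1 * sinh r2 * (1 + y1 * y2))"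
    "lorentz p a = - (sinh r1 * sinh r3 * (1 + y1 * y3))"
    "lorentz p b = - (sinh r1 * sinh r4 * (1 + y1 * y4))"
    "lorentz q a = - (sinh r2 * sinh r3 * (1 + y2 * y3))"
    "lorentz q b = - (sinh r2 * sinh r4 * (1 + y2 * y4))"
    "lorentz a b = - (sinh r3 * sinh r4 * (1 + y3 * y4))"
    using pack unfolding ball_packing_tetrahedron_iff[OF r] y by blast+
  have g': "lorentz a q = - (sinh r3 * sinh r2 * (1 + y3 * y2))"
    "lorentz b q = - (sinh r4 * sinh r2 * (1 + y4 * y2))"
    "lorentz b a = - (sinh r4 * sinh r3 * (1 + y4 * y3))"
    using g lorentz_commute[of a q] lorentz_commute[of b q] lorentz_commute[of b a] by (simp_all add: mult.commute)
  have sq: "lorentz p p = -1" "lorentz q q = -1" "lorentz a a = -1" "lorentz b b = -1"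
    using nd by (auto simp: nondegenerate_tetrahedron_def hyperbolic_space_def)
  show ?thesis
    unfolding tetrahedron_solid_angle_def
      dihedral_angle_packing[OF x gt1 xy S Q \<open>Q > 0\<close> sq g]
      dihedral_angle_packing[OF x(1,3,2,4) gt1(1,3,2,4) xy(1,3,2,4) S'(1) Q'(1) \<open>Q > 0\<close> sq(1,3,2,4) g(2,1,3) g'(1) g(6,5)]
      dihedral_angle_packing[OF x(1,4,2,3) gt1(1,4,2,3) xy(1,4,2,3) S'(2) Q'(2) \<open>Q > 0\<close> sq(1,4,2,3) g(3,1,2) g'(2,3) g(4)]
    by (simp add: algebra_simps)
qed

section \<open>Realizing the tetrahedron in coordinates\<close>

lemma inner_vector_3: "(vector [a, b, c] :: real^3) \<bullet> vector [a', b', c'] = a*a' + b*b' + c*c'"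
  by (simp add: inner_vec_def sum_3)

lemma lorentz_coords:
  "lorentz (vector [a, b, c], d) (vector [a', b', c'], d') = a*a' + b*b' + c*c' - d*d'"
  by (simp add: lorentz_def inner_vector_3)

text \<open>The coordinates are triangular with nonzero diagonal, so a linear relation is solved
  from the last spatial coordinate backwards.\<close>

lemma nondegenerate_tetrahedron_coords:
  fixes q1 q4 a1 a2 a4 b1 b2 b3 b4 :: real
  defines "p \<equiv> (vector [0, 0, 0], 1) :: minkowski" and "q \<equiv> (vector [q1, 0, 0], q4) :: minkowski"
    and "a \<equiv> (vector [a1, a2, 0], a4) :: minkowski" and "b \<equiv> (vector [b1, b2, b3], b4) :: minkowski"
  assumes pos: "q1 > 0" "a2 > 0" "b3 > 0" and time: "q4 > 0" "a4 > 0" "b4 > 0"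
    and sq: "lorentz q q = -1" "lorentz a a = -1" "lorentz b b = -1"
  shows "nondegenerate_tetrahedron p q a b"
proof -
  have "lorentz p p = -1" by (simp add: p_def lorentz_coords)
  then have hyp: "{p, q, a, b} \<subseteq> hyperbolic_space"
    using sq time by (simp add: hyperbolic_space_def p_def q_def a_def b_def)
  have comp: "(vector [x, y, z] :: real^3) = vector [x', y', z'] \<longleftrightarrow> x = x' \<and> y = y' \<and> z = z'"
    for x y z x' y' z' :: real
    by (auto simp: vec_eq_iff forall_3)
  have dist: "distinct [p, q, a, b]"
    using pos by (auto simp: p_def q_def a_def b_def comp)
  have "independent {p, q, a, b}"
  proof -
    have "u p = 0 \<and> u q = 0 \<and> u a = 0 \<and> u b = 0"
      if "(\<Sum>v\<in>{p, q, a, b}. u v *\<^sub>R v) = 0" for u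
    proof -
      have z: "u p *\<^sub>R p + u q *\<^sub>R q + u a *\<^sub>R a + u b *\<^sub>R b = 0"
        using that dist by (simp add: add.assoc)
      have "(\<lambda>v. fst v $ 3) (u p *\<^sub>R p + u q *\<^sub>R q + u a *\<^sub>R a + u b *\<^sub>R b) = 0" unfolding z by simp
      then have ub: "u b = 0" using pos by (simp add: p_def q_def a_def b_def)
      have "(\<lambda>v. fst v $ 2) (u p *\<^sub>R p + u q *\<^sub>R q + u a *\<^sub>R a + u b *\<^sub>R b) = 0" unfolding z by simp
      then have ua: "u a = 0" using pos ub by (simp add: p_def q_def a_def b_def)
      have "(\<lambda>v. fst v $ 1) (u p *\<^sub>R p + u q *\<^sub>R q + u a *\<^sub>R a + u b *\<^sub>R b) = 0" unfolding z by simp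
      then have uq: "u q = 0" using pos ub ua by (simp add: p_def q_def a_def b_def)
      have "snd (u p *\<^sub>R p + u q *\<^sub>R q + u a *\<^sub>R a + u b *\<^sub>R b) = 0" unfolding z by simp
      then have "u p = 0" using ub ua uq by (simp add: p_def)
      with ub ua uq show ?thesis by simp
    qed
    then show ?thesis by (subst dependent_finite) auto
  qed
  with hyp dist show ?thesis by (simp add: nondegenerate_tetrahedron_def)
qed

text \<open>Place \<open>p\<close> at the base point, \<open>q\<close> on the first axis and
  \<open>a\<close> in the plane of the first two axes; the remaining coordinates are then forced up
  to sign. Positivity of \<open>Q\<close> makes the last pivot \<open>2*x4* sqrt Q/G\<close>
  positive. Existence is needed because \<open>solid_angle\<close> is a definite
  description.\<close>

lemma ball_packing_tetrahedron_exists: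
  assumes r: "r1 > 0" "r2 > 0" "r3 > 0" "r4 > 0" and "Q_form r1 r2 r3 r4 > 0"
  shows "\<exists>p q a b. ball_packing_tetrahedron r1 r2 r3 r4 p q a b"
proof -
  define x1 x2 x3 x4 where x_def: "x1 = sinh r1" "x2 = sinh r2" "x3 = sinh r3" "x4 = sinh r4"
  define y1 y2 y3 y4 where y: "y1 = coth r1" "y2 = coth r2" "y3 = coth r3" "y4 = coth r4"
  define S where S: "S = y1+y2+y3+y4"
  define Q where Q: "Q = S^2 - 2*(y1^2+y2^2+y3^2+y4^2) + 4"
  define A B where "A = S - 2*y3" and "B = S - 2*y4"
  define g G where "g = y1 + y2" and "G = sqrt (B^2+Q)"
  define \<kappa> where "\<kappa> = (\<lambda>y z. 2 + y1*y + y1*z + y*z - y1^2)"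
  have x: "x1 > 0" "x2 > 0" "x3 > 0" "x4 > 0" using r by (auto simp: x_def)
  have gt1: "y1 > 1" "y2 > 1" "y3 > 1" "y4 > 1" using r coth_gt_1 y by auto
  have xy: "x1^2 * (y1^2-1) = 1" "x2^2 * (y2^2-1) = 1" "x3^2 * (y3^2-1) = 1" "x4^2 * (y4^2-1) = 1"
    using r sinh_sq_coth y x_def by auto
  have "Q > 0" using assms by (simp add: Q_form_def Q S y)
  have g: "g > 0" using gt1 by (simp add: g_def)
  have BQ: "B^2 + Q > 0" using \<open>Q > 0\<close> by (simp add: add_nonneg_pos)
  then have G: "G > 0" "G^2 = B^2 + Q" by (auto simp: G_def)
  have y0: "1 + t*z > 0" if "t > 1" "z > 1" for t z :: real
    using that by (intro add_pos_pos mult_pos_pos) auto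
  \<comment> \<open>the Cholesky factor of the Gram matrix\<close>
  define p q a b :: minkowski where
    "p = (vector [0, 0, 0], 1 :: real)" and
    "q = (vector [x1*x2*g, 0, 0], x1*x2*(1+y1*y2))" and
    "a = (vector [x1*x3*\<kappa> y2 y3/g, x3*G/g, 0], x1*x3*(1+y1*y3))" and
    "b = (vector [x1*x4*\<kappa> y2 y4/g, x4*(Q-A*B)/(g*G), 2*x4* sqrt Q/G], x1*x4*(1+y1*y4))"
  note defs = p_def q_def a_def b_def
  have pq: "lorentz p q = - (x1*x2*(1+y1*y2))" and pa: "lorentz p a = - (x1*x3*(1+y1*y3))"
    and pb: "lorentz p b = - (x1*x4*(1+y1*y4))"
    unfolding defs lorentz_coords by simp_all
  \<comment> \<open>The second and third coordinates of \<open>q\<close> vanish, so those of the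
    other point are left arbitrary and both \<open>a\<close> and \<open>b\<close> are
    covered.\<close>
  have qa': "x1*x2*g*(x1*t*\<kappa> y2 z/g) + 0*c + 0*d - x1*x2*(1+y1*y2)*(x1*t*(1+y1*z)) = - (x2*t*(1+y2*z))" for t z c d
  proof -
    have "x1*x2*g*(x1*t*\<kappa> y2 z/g) + 0*c + 0*d - x1*x2*(1+y1*y2)*(x1*t*(1+y1*z))
        = x1^2*(\<kappa> y2 z - (1+y1*y2)*(1+y1*z))*(x2*t)"
      using g by (simp add: power2_eq_square algebra_simps)
    also have "\<dots> = - (x1^2*(y1^2-1))*(x2*t*(1+y2*z))" unfolding \<kappa>_def by algebra
    finally show ?thesis using xy by simp
  qed
  have qa: "lorentz q a = - (x2*x3*(1+y2*y3))" and qb: "lorentz q b = - (x2*x4*(1+y2*y4))"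
    unfolding defs lorentz_coords qa' by (rule refl)+
  have qq: "lorentz q q = -1"
  proof -
    have "lorentz q q = - ((x1^2*(y1^2-1)) * (x2^2*(y2^2-1)))"
      unfolding defs lorentz_coords g_def by algebra
    then show ?thesis using xy by simp
  qed
  have ab: "lorentz a b = - (x3*x4*(1+y3*y4))"
  proof -
    have "lorentz a b = (x1*x3*\<kappa> y2 y3/g)*(x1*x4*\<kappa> y2 y4/g) + x3*x4*(Q-A*B)/(g*g) - x1*x3*(1+y1*y3)*(x1*x4*(1+y1*y4))"
      unfolding defs lorentz_coords using G(1) by simp
    also have "\<dots> = x3*x4*((x1^2*\<kappa> y2 y3*\<kappa> y2 y4 + (x1^2*(y1^2-1))*(Q-A*B))/g^2 - x1^2*(1+y1*y3)*(1+y1*y4))"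
      using g unfolding xy by (simp add: field_simps power2_eq_square)
    also have "x1^2*\<kappa> y2 y3*\<kappa> y2 y4 + (x1^2*(y1^2-1))*(Q-A*B) = g^2*(x1^2*\<kappa> y3 y4)"
      unfolding \<kappa>_def A_def B_def Q S g_def by algebra
    also have "g^2*(x1^2*\<kappa> y3 y4)/g^2 - x1^2*(1+y1*y3)*(1+y1*y4) = - (x1^2*(y1^2-1))*(1+y3*y4)"
    proof -
      have "g^2*(x1^2*\<kappa> y3 y4)/g^2 = x1^2*\<kappa> y3 y4" using g by simp
      then show ?thesis by (simp add: \<kappa>_def algebra_simps power2_eq_square)
    qed
    finally show ?thesis unfolding xy by (simp add: algebra_simps)
  qed
  have sq: "(x1*t*\<kappa> y2 z/g)*(x1*t*\<kappa> y2 z/g) + t^2*D/g^2 - x1*t*(1+y1*z)*(x1*t*(1+y1*z)) = -1"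
    if "(y1+z)^2*g^2 - \<kappa> y2 z*\<kappa> y2 z = (y1^2-1)*D" "t^2*(z^2-1) = 1" for t z D
  proof -
    have "(x1*t*\<kappa> y2 z/g)*(x1*t*\<kappa> y2 z/g) + t^2*D/g^2 - x1*t*(1+y1*z)*(x1*t*(1+y1*z))
        = t^2*((x1^2*(\<kappa> y2 z*\<kappa> y2 z) + (x1^2*(y1^2-1))*D)/g^2 - x1^2*(1+y1*z)^2)"
      using g unfolding xy by (simp add: field_simps power2_eq_square)
    also have "x1^2*(\<kappa> y2 z*\<kappa> y2 z) + (x1^2*(y1^2-1))*D = g^2*(x1^2*(y1+z)^2)"
      using that(1) by algebra
    also have "t^2*(g^2*(x1^2*(y1+z)^2)/g^2 - x1^2*(1+y1*z)^2) = - ((x1^2*(y1^2-1)) * (t^2*(z^2-1)))"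
    proof -
      have "g^2*(x1^2*(y1+z)^2)/g^2 = x1^2*(y1+z)^2" using g by simp
      then show ?thesis by (simp add: algebra_simps power2_eq_square)
    qed
    finally show ?thesis unfolding xy that(2) by simp
  qed
  have aa: "lorentz a a = -1"
  proof -
    have "(y1+y3)^2*g^2 - \<kappa> y2 y3*\<kappa> y2 y3 = (y1^2-1)*(B^2+Q)"
      unfolding \<kappa>_def B_def Q S g_def by algebra
    from sq[OF this xy(3)] show ?thesis
      unfolding defs lorentz_coords G(2)[symmetric] by (simp add: power2_eq_square ac_simps)
  qed
  have bb: "lorentz b b = -1"
  proof -
    have "(y1+y4)^2*g^2 - \<kappa> y2 y4*\<kappa> y2 y4 = (y1^2-1)*(A^2+Q)"
      unfolding \<kappa>_def A_def Q S g_def by algebra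
    note sq[OF this xy(4)]
    moreover have "(x4*(Q-A*B)/(g*G))*(x4*(Q-A*B)/(g*G)) + (2*x4* sqrt Q/G)*(2*x4* sqrt Q/G) = x4^2*(A^2+Q)/g^2"
    proof -
      have "(2*x4* sqrt Q/G)*(2*x4* sqrt Q/G) = 4*x4^2*Q/G^2"
        using \<open>Q > 0\<close> by (simp add: power2_eq_square)
      moreover have "(x4*(Q-A*B)/(g*G))*(x4*(Q-A*B)/(g*G)) + 4*x4^2*Q/G^2 = x4^2*((Q-A*B)^2 + 4*g^2*Q)/(g^2*G^2)"
        using g G(1) by (simp add: field_simps power2_eq_square)
      \<comment> \<open>With \<open>4*g^2 = (A+B)^2\<close> this is the two-squares identity for
        \<open>(A^2+Q)*(B^2+Q)\<close>.\<close>
      moreover have "(Q-A*B)^2 + 4*g^2*Q = (A^2+Q)*G^2"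
      proof -
        have "A + B = 2*g" by (simp add: A_def B_def g_def S)
        then have "4*g^2 = (A+B)^2" by (simp add: power2_eq_square)
        then show ?thesis unfolding G(2) by algebra
      qed
      ultimately show ?thesis using g G(1) by simp
    qed
    ultimately show ?thesis
      unfolding defs lorentz_coords by (simp add: add.assoc)
  qed
  have "nondegenerate_tetrahedron p q a b"
    unfolding defs
    using x g G(1) \<open>Q > 0\<close> y0 gt1 qq aa bb unfolding defs
    by (intro nondegenerate_tetrahedron_coords) simp_all
  then show ?thesis
    unfolding ball_packing_tetrahedron_iff[OF r]
    using pq pa pb qa qb ab unfolding x_def y by blast
qed

section \<open>Solid angles as sums of corner angles\<close>

lemma solid_angle_eq:
  assumes r: "r1 > 0" "r2 > 0" "r3 > 0" "r4 > 0"
    and y: "y1 = coth r1" "y2 = coth r2" "y3 = coth r3" "y4 = coth r4"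
    and S: "S = y1+y2+y3+y4" and Q: "Q = S^2 - 2*(y1^2+y2^2+y3^2+y4^2) + 4" and "Q > 0"
  shows "solid_angle r1 r2 r3 r4 = 2*pi - 2*(corner_angle S Q y2 + corner_angle S Q y3 + corner_angle S Q y4)"
proof -
  note eq = tetrahedron_solid_angle_packing[OF assms]
  have "Q_form r1 r2 r3 r4 > 0" using \<open>Q > 0\<close> by (simp add: Q_form_def Q S y)
  then obtain p q a b where "ball_packing_tetrahedron r1 r2 r3 r4 p q a b"
    using ball_packing_tetrahedron_exists[OF r] by blast
  then show ?thesis
    unfolding solid_angle_def using eq by (intro the_equality) (metis eq)+
qed

text \<open>For \<open>Q \<le> 0\<close> exactly one of the numbers \<open>S - 2*yi\<close> is
  negative: the sum of any two is positive, and \<open>Q\<close> would be positive if all four were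
  nonnegative. The corner angle is \<open>pi\<close> at that vertex and \<open>0\<close> at the
  others, so the formula gives \<open>2*pi\<close> if it is the first vertex and \<open>0\<close>
  otherwise.\<close>

lemma ext_solid_angle_eq:
  assumes r: "r1 > 0" "r2 > 0" "r3 > 0" "r4 > 0"
    and y: "y1 = coth r1" "y2 = coth r2" "y3 = coth r3" "y4 = coth r4"
    and S: "S = y1+y2+y3+y4" and Q: "Q = S^2 - 2*(y1^2+y2^2+y3^2+y4^2) + 4"
  shows "ext_solid_angle r1 r2 r3 r4 = 2*pi - 2*(corner_angle S Q y2 + corner_angle S Q y3 + corner_angle S Q y4)"
proof (cases "Q > 0")
  case True
  then have "Q_form r1 r2 r3 r4 > 0" by (simp add: Q_form_def Q S y)
  with solid_angle_eq[OF assms True] show ?thesis by (simp add: ext_solid_angle_def)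
next
  case False
  then have "\<not> Q_form r1 r2 r3 r4 > 0" by (simp add: Q_form_def Q S y)
  have gt1: "y1 > 1" "y2 > 1" "y3 > 1" "y4 > 1" using r coth_gt_1 y by auto
  have zero: "corner_angle S Q z = 0" if "S - 2*z > 0" for z
    using False that by (simp add: corner_angle_def max_def)
  have pi: "corner_angle S Q z = pi" if "S - 2*z < 0" for z
  proof -
    have "(S - 2*z) / \<bar>S - 2*z\<bar> = -1" using that by (simp add: divide_eq_eq)
    then show ?thesis using False by (simp add: corner_angle_def max_def)
  qed
  \<comment> \<open>Here \<open>Q = 4*m - (S - 2*y1)^2\<close>, so \<open>Q \<le> 0\<close> forces
    \<open>S - 2*y1\<close> out of the open interval between \<open>- 2 * sqrt m\<close> and
    \<open>2 * sqrt m\<close>. The degeneracy inequality thus reduces to a sign.\<close>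
  have deg: "degenerate_at r1 r2 r3 r4 \<longleftrightarrow> S - 2*y1 < 0"
  proof -
    define m where "m = y2*y3 + y3*y4 + y4*y2 + 1"
    have "m > 0" using gt1 by (simp add: m_def add_pos_pos)
    have Q': "Q = 4*m - (S - 2*y1)^2" unfolding Q S m_def by algebra
    have "2 * sqrt m = sqrt (4*m)" by (simp add: real_sqrt_mult)
    also have "\<dots> \<le> \<bar>S - 2*y1\<bar>" using False Q' by (simp add: real_sqrt_le_iff flip: real_sqrt_abs)
    finally have "2 * sqrt m \<le> \<bar>S - 2*y1\<bar>" .
    moreover have "sqrt m > 0" using \<open>m > 0\<close> by simp
    ultimately show ?thesis
      unfolding degenerate_at_def y[symmetric] m_def[symmetric] using S by linarith
  qed
  consider "S - 2*y1 < 0" | "S - 2*y2 < 0" | "S - 2*y3 < 0" | "S - 2*y4 < 0"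
  proof -
    have "Q > 0" if "S - 2*y1 \<ge> 0" "S - 2*y2 \<ge> 0" "S - 2*y3 \<ge> 0" "S - 2*y4 \<ge> 0"
    proof -
      have "Q = y1*(S-2*y1) + y2*(S-2*y2) + y3*(S-2*y3) + y4*(S-2*y4) + 4"
        unfolding Q S by algebra
      also have "\<dots> > 0" using that gt1 by (intro add_nonneg_pos add_nonneg_nonneg mult_nonneg_nonneg) auto
      finally show ?thesis .
    qed
    then show ?thesis using that False by linarith
  qed
  then have "2*pi - 2*(corner_angle S Q y2 + corner_angle S Q y3 + corner_angle S Q y4)
    = (if S - 2*y1 < 0 then 2*pi else 0)"
  proof cases
    case 1
    then show ?thesis using zero[of y2] zero[of y3] zero[of y4] S gt1 by simp
  next
    case 2
    then show ?thesis using pi[of y2] zero[of y3] zero[of y4] S gt1 by simp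
  next
    case 3
    then show ?thesis using zero[of y2] pi[of y3] zero[of y4] S gt1 by simp
  next
    case 4
    then show ?thesis using zero[of y2] zero[of y3] pi[of y4] S gt1 by simp
  qed
  then show ?thesis
    using \<open>\<not> Q_form r1 r2 r3 r4 > 0\<close> deg by (simp add: ext_solid_angle_def)
qed

section \<open>Monotonicity of the extended solid angles\<close>

text \<open>Otherwise some value \<open>c\<close> strictly between \<open>f a\<close> and
  \<open>f b\<close> avoids \<open>Z\<close>. At the last time \<open>s\<close> with
  \<open>f s \<le> c\<close> the value is \<open>c\<close>, so \<open>s\<close> lies in
  \<open>U\<close>; but \<open>f\<close> does not increase just after \<open>s\<close>, which
  contradicts the choice of \<open>s\<close>.\<close>

lemma nonincreasing_off_finite_values:
  fixes f :: "real \<Rightarrow> real"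
  assumes "a \<le> b" and cont: "continuous_on {a..b} f" and "open U" and "finite Z"
    and deriv: "\<And>s. s \<in> U \<inter> {a<..<b} \<Longrightarrow> \<exists>D. (f has_real_derivative D) (at s) \<and> D \<le> 0"
    and Z: "\<And>s. s \<in> {a<..<b} - U \<Longrightarrow> f s \<in> Z"
  shows "f b \<le> f a"
proof (rule ccontr)
  assume "\<not> f b \<le> f a"
  then have "infinite ({f a<..<f b} - Z)"
    using \<open>finite Z\<close> by (simp add: infinite_Ioo)
  then have "{f a<..<f b} - Z \<noteq> {}" by (intro notI) simp
  then obtain c where "c \<in> {f a<..<f b} - Z" by blast
  then have c: "f a < c" "c < f b" "c \<notin> Z" by auto
  define A where "A = {s \<in> {a..b}. f s \<le> c}"
  have "closed A"
    unfolding A_def by (intro continuous_on_closed_Collect_le cont continuous_on_const) auto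
  moreover have "bounded A"
    by (rule bounded_subset[OF bounded_closed_interval[of a b]]) (auto simp: A_def)
  ultimately have "compact A" by (simp add: compact_eq_bounded_closed)
  have "A \<noteq> {}"
  proof -
    have "a \<in> A" using c \<open>a \<le> b\<close> by (simp add: A_def)
    then show ?thesis by blast
  qed
  obtain s where s: "s \<in> A" "\<And>x. x \<in> A \<Longrightarrow> x \<le> s"
    using compact_attains_sup[OF \<open>compact A\<close> \<open>A \<noteq> {}\<close>] by auto
  have sab: "a \<le> s" "s \<le> b" "f s \<le> c" using s(1) by (auto simp: A_def)
  have "continuous_on {s..b} f" using cont sab continuous_on_subset by fastforce
  then obtain x where "s \<le> x" "x \<le> b" "f x = c"
    using IVT'[of f s c b] sab c by auto
  then have fs: "f s = c" using s(2)[of x] sab by (auto simp: A_def)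
  then have "a \<noteq> s" "s \<noteq> b" using c by auto
  then have "a < s" "s < b" using sab by auto
  then have "s \<in> U \<inter> {a<..<b}" using Z[of s] fs c by auto
  moreover have "open (U \<inter> {a<..<b})" using \<open>open U\<close> by auto
  ultimately obtain e where e: "e > 0" "cball s e \<subseteq> U \<inter> {a<..<b}"
    using open_contains_cball by blast
  have mem: "x \<in> U \<inter> {a<..<b}" if "s \<le> x" "x \<le> s + e" for x
  proof (rule subsetD[OF e(2)])
    show "x \<in> cball s e" using that by (simp add: dist_real_def)
  qed
  have "f (s + e) \<le> f s"
  proof (rule DERIV_nonpos_imp_nonincreasing[of s "s + e" f])
    show "s \<le> s + e" using e(1) by simp
    show "\<exists>D. (f has_real_derivative D) (at x) \<and> D \<le> 0" if "s \<le> x" "x \<le> s + e" for x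
      by (rule deriv[OF mem[OF that]])
  qed
  moreover have "s + e \<in> {a..b}" using mem[of "s+e"] e(1) by simp
  ultimately have "s + e \<in> A" using fs by (simp add: A_def)
  then have "s + e \<le> s" by (rule s(2))
  then show False using e(1) by simp
qed

section \<open>Derivative and continuity of the corner angle\<close>

lemma has_real_derivative_coth:
  assumes "x \<noteq> 0"
  shows "(coth has_real_derivative - ((coth x)^2 - 1)) (at x)"
proof -
  have "sinh x \<noteq> 0" using assms by simp
  then have "((\<lambda>x. cosh x / sinh x) has_real_derivative - ((cosh x / sinh x)^2 - 1)) (at x)"
    by (auto intro!: derivative_eq_intros simp: field_simps power2_eq_square)
  then show ?thesis by (simp add: coth_def[abs_def])
qed

lemma corner_angle_arctan:
  assumes "Q > 0"
  shows "corner_angle S Q y = pi/2 - arctan ((S - 2*y) / sqrt Q)"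
proof -
  let ?t = "(S - 2*y) / sqrt Q"
  have "(S - 2*y) / sqrt ((S - 2*y)^2 + max 0 Q) = sin (arctan ?t)"
  proof -
    have "sqrt (1 + ?t^2) = sqrt ((S - 2*y)^2 + Q) / sqrt Q"
      using assms by (simp add: power_divide add_divide_eq_iff ac_simps flip: real_sqrt_divide)
    then show ?thesis unfolding sin_arctan using assms by simp
  qed
  then have "corner_angle S Q y = arccos (cos (pi/2 - arctan ?t))"
    by (simp add: corner_angle_def cos_sin_eq)
  also have "\<dots> = pi/2 - arctan ?t"
    using arctan_bounded[of ?t] by (intro arccos_cos) auto
  finally show ?thesis .
qed

text \<open>Writing the derivative of \<open>Q\<close> as \<open>2*Q'\<close> cancels the factor
  from the square root. For \<open>Q' = S*V - 2*P\<close> the quotient before the division by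
  \<open>sqrt (Q s)\<close> is the \<open>u\<close> of the Jacobian identities.\<close>

lemma corner_angle_has_derivative:
  assumes S: "(S has_real_derivative V) (at s)" and Q: "(Q has_real_derivative 2*Q') (at s)"
    and y: "(y has_real_derivative w) (at s)" and pos: "Q s > 0"
  shows "((\<lambda>s. corner_angle (S s) (Q s) (y s)) has_real_derivative
    ((S s - 2*y s)*Q' - (V - 2*w)*Q s) / ((S s - 2*y s)^2 + Q s) / sqrt (Q s)) (at s)"
proof -
  define A q where "A = S s - 2*y s" and "q = sqrt (Q s)"
  have q: "q > 0" "Q s = q^2" using pos by (auto simp: q_def)
  have "A^2 + q^2 > 0" using q by (simp add: add_nonneg_pos)
  have "((\<lambda>s. pi/2 - arctan ((S s - 2*y s) / sqrt (Q s))) has_real_derivative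
     0 - inverse (1 + (A/q)^2) * (((V - 2*w)*q - A*(2*Q' * (inverse q / 2))) / (q*q))) (at s)"
    unfolding A_def q_def
    by (rule derivative_eq_intros S Q y refl | use pos in simp)+
  also have "0 - inverse (1 + (A/q)^2) * (((V - 2*w)*q - A*(2*Q' * (inverse q / 2))) / (q*q))
     = (A*Q' - (V - 2*w)*q^2) / (A^2 + q^2) / q"
  proof -
    have 1: "inverse (1 + (A/q)^2) = q^2 / (A^2 + q^2)"
      using q \<open>A^2 + q^2 > 0\<close> by (simp add: power_divide field_simps)
    show ?thesis
      unfolding 1 using q \<open>A^2 + q^2 > 0\<close> by (simp add: divide_simps power2_eq_square)
  qed
  finally have *: "((\<lambda>s. pi/2 - arctan ((S s - 2*y s) / sqrt (Q s))) has_real_derivative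
     (A*Q' - (V - 2*w)*q^2) / (A^2 + q^2) / q) (at s)" .
  have "isCont Q s" using Q by (rule DERIV_isCont)
  then have "\<forall>\<^sub>F x in nhds s. Q x > 0"
    using pos unfolding continuous_at by (auto simp: isCont_def tendsto_at_iff_tendsto_nhds intro: order_tendstoD)
  then have "\<forall>\<^sub>F x in nhds s. corner_angle (S x) (Q x) (y x) = pi/2 - arctan ((S x - 2*y x) / sqrt (Q x))"
    by eventually_elim (rule corner_angle_arctan)
  from DERIV_cong_ev[OF refl this refl] * show ?thesis
    unfolding A_def q_def by (simp add: pos less_imp_le)
qed

text \<open>The last hypothesis excludes exactly the zeros of the denominator.\<close>

lemma continuous_on_corner_angle:
  assumes "continuous_on A S" "continuous_on A Q" "continuous_on A y"
    and "\<And>s. s \<in> A \<Longrightarrow> Q s > 0 \<or> S s \<noteq> 2 * y s"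
  shows "continuous_on A (\<lambda>s. corner_angle (S s) (Q s) (y s))"
proof -
  have pos: "(S s - 2*y s)^2 + max 0 (Q s) > 0" if "s \<in> A" for s
    using assms(4)[OF that] by (auto intro: add_nonneg_pos add_pos_nonneg)
  have "continuous_on A (\<lambda>s. (S s - 2*y s) / sqrt ((S s - 2*y s)^2 + max 0 (Q s)))"
    using assms pos by (intro continuous_intros) force+
  then show ?thesis
    unfolding corner_angle_def
  proof (rule continuous_on_arccos)
    show "\<forall>s\<in>A. - 1 \<le> (S s - 2*y s) / sqrt ((S s - 2*y s)^2 + max 0 (Q s)) \<and>
        (S s - 2*y s) / sqrt ((S s - 2*y s)^2 + max 0 (Q s)) \<le> 1"
    proof
      fix s
      have "\<bar>(S s - 2*y s) / sqrt ((S s - 2*y s)^2 + max 0 (Q s))\<bar> \<le> 1" by (rule abs_divide_sqrt_le_1) simp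
      then show "- 1 \<le> (S s - 2*y s) / sqrt ((S s - 2*y s)^2 + max 0 (Q s)) \<and>
        (S s - 2*y s) / sqrt ((S s - 2*y s)^2 + max 0 (Q s)) \<le> 1"
        unfolding abs_le_iff by linarith
    qed
  qed
qed

section \<open>Angles of a tetrahedron given by its vertex set\<close>

definition coth_sum :: "('a \<Rightarrow> real) \<Rightarrow> 'a set \<Rightarrow> real" where
  "coth_sum r \<sigma> = (\<Sum>m\<in>\<sigma>. coth (r m))"

definition coth_form :: "('a \<Rightarrow> real) \<Rightarrow> 'a set \<Rightarrow> real" where
  "coth_form r \<sigma> = (coth_sum r \<sigma>)^2 - 2 * (\<Sum>m\<in>\<sigma>. (coth (r m))^2) + 4"

text \<open>For four positive radii this is the extended solid angle, without its case distinction.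
  Indexing by an unordered vertex set builds in the symmetry and suits sums over tetrahedra.\<close>

definition packing_angle :: "('a \<Rightarrow> real) \<Rightarrow> 'a set \<Rightarrow> 'a \<Rightarrow> real" where
  "packing_angle r \<sigma> i =
     2*pi - 2 * (\<Sum>k\<in>\<sigma>-{i}. corner_angle (coth_sum r \<sigma>) (coth_form r \<sigma>) (coth (r k)))"

lemma card_4_distinctE:
  assumes "card \<sigma> = 4"
  obtains i j k l where "\<sigma> = {i, j, k, l}" "distinct [i, j, k, l]"
proof -
  have "card \<sigma> = Suc (Suc (Suc (Suc 0)))" using assms by simp
  then show ?thesis unfolding card_Suc_eq using that by auto
qed

lemma ext_solid_angle_eq_packing_angle:
  assumes "distinct [i, j, k, l]" "r i > 0" "r j > 0" "r k > 0" "r l > 0"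
  shows "ext_solid_angle (r i) (r j) (r k) (r l) = packing_angle r {i, j, k, l} i"
proof -
  have "{i, j, k, l} - {i} = {j, k, l}" using assms by auto
  then have "packing_angle r {i, j, k, l} i =
    2*pi - 2 * (corner_angle (coth_sum r {i, j, k, l}) (coth_form r {i, j, k, l}) (coth (r j))
      + corner_angle (coth_sum r {i, j, k, l}) (coth_form r {i, j, k, l}) (coth (r k))
      + corner_angle (coth_sum r {i, j, k, l}) (coth_form r {i, j, k, l}) (coth (r l)))"
    using assms by (simp add: packing_angle_def)
  moreover have "coth_sum r {i, j, k, l} = coth (r i) + coth (r j) + coth (r k) + coth (r l)"
    "coth_form r {i, j, k, l} = (coth_sum r {i, j, k, l})^2
      - 2 * ((coth (r i))^2 + (coth (r j))^2 + (coth (r k))^2 + (coth (r l))^2) + 4"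
    using assms by (simp_all add: coth_sum_def coth_form_def)
  ultimately show ?thesis
    using ext_solid_angle_eq[OF assms(2-5) refl refl refl refl, of "coth_sum r {i, j, k, l}" "coth_form r {i, j, k, l}"]
    by simp
qed

lemma packing_angle_eq_ext_solid_angle:
  assumes "card \<sigma> = 4" "\<And>m. m \<in> \<sigma> \<Longrightarrow> r m > 0" "i \<in> \<sigma>"
  obtains j k l where "\<sigma> = {i, j, k, l}" "distinct [i, j, k, l]"
    "packing_angle r \<sigma> i = ext_solid_angle (r i) (r j) (r k) (r l)"
proof -
  have "finite \<sigma>" using assms(1) card.infinite by fastforce
  then have "card (\<sigma> - {i}) = Suc (Suc (Suc 0))" using assms by simp
  then obtain j k l where "\<sigma> - {i} = {j, k, l}" "distinct [j, k, l]"
    unfolding card_Suc_eq by auto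
  then have *: "\<sigma> = {i, j, k, l}" "distinct [i, j, k, l]" using assms(3) by auto
  with that ext_solid_angle_eq_packing_angle[OF *(2), of r] assms(2) show ?thesis by auto
qed

lemma packing_angle_degenerate:
  assumes "card \<sigma> = 4" "\<And>m. m \<in> \<sigma> \<Longrightarrow> r m > 0" "i \<in> \<sigma>" "coth_form r \<sigma> \<le> 0"
  shows "packing_angle r \<sigma> i \<in> {0, 2*pi}"
proof -
  obtain j k l where *: "\<sigma> = {i, j, k, l}" "distinct [i, j, k, l]"
    "packing_angle r \<sigma> i = ext_solid_angle (r i) (r j) (r k) (r l)"
    by (rule packing_angle_eq_ext_solid_angle[OF assms(1-3)])
  then have "Q_form (r i) (r j) (r k) (r l) = coth_form r \<sigma>"
    by (simp add: Q_form_def coth_form_def coth_sum_def add.assoc)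
  with * assms(4) show ?thesis by (simp add: ext_solid_angle_def)
qed

text \<open>Equality would make one hyperbolic cotangent the sum of the other three, and then the
  form is \<open>4 * (b*c + c*d + b*d) + 4 > 0\<close>. Thus the corner angles stay continuous
  across the boundary of the degenerate region.\<close>

lemma coth_sum_ne_if_degenerate:
  assumes "card \<sigma> = 4" "\<And>m. m \<in> \<sigma> \<Longrightarrow> r m > 0" "i \<in> \<sigma>" "coth_form r \<sigma> \<le> 0"
  shows "coth_sum r \<sigma> \<noteq> 2 * coth (r i)"
proof
  assume eq: "coth_sum r \<sigma> = 2 * coth (r i)"
  obtain j k l where *: "\<sigma> = {i, j, k, l}" "distinct [i, j, k, l]"
    by (rule packing_angle_eq_ext_solid_angle[OF assms(1-3)])
  define a b c d where abcd: "a = coth (r i)" "b = coth (r j)" "c = coth (r k)" "d = coth (r l)"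
  have gt1: "b > 1" "c > 1" "d > 1" using coth_gt_1 assms(2) * by (auto simp: abcd)
  have a: "a = b + c + d" using eq * by (simp add: coth_sum_def abcd)
  have "coth_form r \<sigma> = (2*a)^2 - 2*(a^2 + b^2 + c^2 + d^2) + 4"
    unfolding coth_form_def eq using * by (simp add: abcd)
  then have "coth_form r \<sigma> = 4 * (b*c + c*d + b*d) + 4"
    unfolding a by algebra
  also have "\<dots> > 0" using gt1 by (intro add_pos_pos mult_pos_pos) auto
  finally show False using assms(4) by simp
qed

lemma packing_angle_monotone:
  assumes card: "card \<sigma> = 4" and r: "\<And>i. i \<in> \<sigma> \<Longrightarrow> r i > 0" and r': "\<And>i. i \<in> \<sigma> \<Longrightarrow> r' i > 0"
  shows "(\<Sum>i\<in>\<sigma>. (packing_angle r' \<sigma> i - packing_angle r \<sigma> i) * (r' i - r i)) \<le> 0"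
proof -
  have fin: "finite \<sigma>" using card card.infinite by fastforce
  define \<delta> where "\<delta> = (\<lambda>i. r' i - r i)"
  define x where "x = (\<lambda>s i. r i + s * \<delta> i)"
  have x_pos: "x s i > 0" if "0 \<le> s" "s \<le> 1" "i \<in> \<sigma>" for s i
  proof -
    have "x s i = (1 - s) * r i + s * r' i" by (simp add: x_def \<delta>_def algebra_simps)
    also have "\<dots> > 0"
      using that r[of i] r'[of i]
      by (cases "s = 0") (auto intro: add_nonneg_pos mult_nonneg_nonneg less_imp_le)
    finally show ?thesis .
  qed
  define f where "f = (\<lambda>s. \<Sum>i\<in>\<sigma>. packing_angle (x s) \<sigma> i * \<delta> i)"
  define w where "w = (\<lambda>s i. - ((coth (x s i))^2 - 1) * \<delta> i)"
  have dy: "((\<lambda>s. coth (x s i)) has_real_derivative w s i) (at s)" if "0 \<le> s" "s \<le> 1" "i \<in> \<sigma>" for s i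
  proof -
    have "((\<lambda>s. x s i) has_real_derivative \<delta> i) (at s)"
      unfolding x_def by (auto intro!: derivative_eq_intros)
    with has_real_derivative_coth[of "x s i"] x_pos[OF that] show ?thesis
      unfolding w_def by (intro DERIV_chain2[of coth]) auto
  qed
  have cont: "continuous_on {0..1} (\<lambda>s. coth (x s i))" if "i \<in> \<sigma>" for i
    using that by (intro continuous_at_imp_continuous_on ballI DERIV_isCont[OF dy]) auto
  have cont_sum: "continuous_on {0..1} (\<lambda>s. coth_sum (x s) \<sigma>)"
    unfolding coth_sum_def by (intro continuous_intros cont)
  have cont_form: "continuous_on {0..1} (\<lambda>s. coth_form (x s) \<sigma>)"
    unfolding coth_form_def by (intro continuous_intros cont cont_sum)
  have cont_f: "continuous_on {0..1} f"
    unfolding f_def packing_angle_def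
  proof (intro continuous_intros continuous_on_corner_angle cont_sum cont_form cont)
    fix i k s assume "i \<in> \<sigma>" "k \<in> \<sigma> - {i}" "s \<in> {0..1::real}"
    then show "coth_form (x s) \<sigma> > 0 \<or> coth_sum (x s) \<sigma> \<noteq> 2 * coth (x s k)"
      using coth_sum_ne_if_degenerate[OF card, of "x s" k] x_pos[of s] by force
  qed auto
  define U where "U = {0<..<1} \<inter> (\<lambda>s. coth_form (x s) \<sigma>) -` {0<..}"
  have "open U"
    unfolding U_def
    by (rule continuous_open_preimage[OF continuous_on_subset[OF cont_form]]) auto
  \<comment> \<open>In the degenerate region every angle is \<open>0\<close> or \<open>2*pi\<close>,
    so \<open>f\<close> takes only the finitely many subset sums of the numbers
    \<open>2*pi * \<delta> i\<close>.\<close>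
  define Z where "Z = (\<lambda>A. \<Sum>i\<in>A. 2*pi * \<delta> i) ` Pow \<sigma>"
  have "finite Z" using fin by (simp add: Z_def)
  have f_degenerate: "f s \<in> Z" if "s \<in> {0<..<1} - U" for s
  proof -
    have "coth_form (x s) \<sigma> \<le> 0" using that by (auto simp: U_def)
    then have deg: "packing_angle (x s) \<sigma> i \<in> {0, 2*pi}" if "i \<in> \<sigma>" for i
      using packing_angle_degenerate[OF card, of "x s" i] x_pos[of s] that \<open>s \<in> {0<..<1} - U\<close> by simp
    have "f s = (\<Sum>i\<in>\<sigma>. if packing_angle (x s) \<sigma> i = 2*pi then 2*pi * \<delta> i else 0)"
      unfolding f_def using deg by (intro sum.cong) auto
    also have "\<dots> = (\<Sum>i\<in>{i\<in>\<sigma>. packing_angle (x s) \<sigma> i = 2*pi}. 2*pi * \<delta> i)"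
      using fin by (simp add: sum.If_cases Int_def)
    finally show ?thesis unfolding Z_def by blast
  qed
  have deriv: "\<exists>D. (f has_real_derivative D) (at s) \<and> D \<le> 0" if "s \<in> U \<inter> {0<..<1}" for s
  proof -
    have s: "0 \<le> s" "s \<le> 1" and pos: "coth_form (x s) \<sigma> > 0" using that by (auto simp: U_def)
    define S Q P V where "S = coth_sum (x s) \<sigma>" and "Q = coth_form (x s) \<sigma>"
      and "P = (\<Sum>i\<in>\<sigma>. coth (x s i) * w s i)" and "V = (\<Sum>i\<in>\<sigma>. w s i)"
    define u where "u = (\<lambda>k. ((S - 2 * coth (x s k)) * (S*V - 2*P) - (V - 2 * w s k)*Q) / ((S - 2 * coth (x s k))^2 + Q))"
    have dS: "((\<lambda>s. coth_sum (x s) \<sigma>) has_real_derivative V) (at s)"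
      unfolding coth_sum_def V_def using s by (intro DERIV_sum dy)
    have dQ: "((\<lambda>s. coth_form (x s) \<sigma>) has_real_derivative 2*(S*V - 2*P)) (at s)"
    proof -
      have "((\<lambda>s. \<Sum>i\<in>\<sigma>. (coth (x s i))^2) has_real_derivative (\<Sum>i\<in>\<sigma>. 2 * coth (x s i) * w s i)) (at s)"
      proof (rule DERIV_sum)
        fix i assume "i \<in> \<sigma>"
        from DERIV_power[OF dy[OF s this], of 2]
        show "((\<lambda>s. (coth (x s i))^2) has_real_derivative 2 * coth (x s i) * w s i) (at s)"
          by (simp add: ac_simps)
      qed
      from DERIV_add[OF DERIV_diff[OF DERIV_power[OF dS, of 2] DERIV_cmult[OF this, of 2]] DERIV_const[of 4]]
      have "((\<lambda>s. coth_form (x s) \<sigma>) has_real_derivative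
          2*S*V - 2 * (\<Sum>i\<in>\<sigma>. 2 * coth (x s i) * w s i)) (at s)"
        unfolding coth_form_def S_def by (simp add: ac_simps)
      moreover have "(\<Sum>i\<in>\<sigma>. 2 * coth (x s i) * w s i) = 2 * P"
        unfolding P_def sum_distrib_left by (intro sum.cong) auto
      ultimately show ?thesis by (simp add: algebra_simps)
    qed
    have dc: "((\<lambda>s. corner_angle (coth_sum (x s) \<sigma>) (coth_form (x s) \<sigma>) (coth (x s k)))
        has_real_derivative u k / sqrt Q) (at s)" if "k \<in> \<sigma>" for k
      using corner_angle_has_derivative[OF dS dQ dy[OF s that] pos] by (simp add: u_def S_def Q_def)
    have "(f has_real_derivative (\<Sum>i\<in>\<sigma>. (0 - 2 * (\<Sum>k\<in>\<sigma>-{i}. u k / sqrt Q)) * \<delta> i)) (at s)"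
      unfolding f_def packing_angle_def
      by (intro DERIV_sum DERIV_cmult_right DERIV_diff DERIV_const DERIV_cmult dc) auto
    moreover have "(\<Sum>i\<in>\<sigma>. (0 - 2 * (\<Sum>k\<in>\<sigma>-{i}. u k / sqrt Q)) * \<delta> i) \<le> 0"
    proof -
      obtain i j k l where *: "\<sigma> = {i, j, k, l}" "distinct [i, j, k, l]"
        by (rule card_4_distinctE[OF card])
      have gt1: "coth (x s m) > 1" if "m \<in> \<sigma>" for m using coth_gt_1 x_pos[OF s that] by simp
      have ww: "w s m = - ((coth (x s m))^2 - 1) * \<delta> m" for m by (simp add: w_def)
      have uk: "((S - 2 * coth (x s k))^2 + Q) * u k = (S - 2 * coth (x s k)) * (S*V - 2*P) - (V - 2 * w s k)*Q" for k
      proof -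
        have "(S - 2 * coth (x s k))^2 + Q > 0" using pos by (simp add: Q_def add_nonneg_pos)
        then show ?thesis by (simp add: u_def)
      qed
      have "0 \<le> u i * (\<delta> j + \<delta> k + \<delta> l) + u j * (\<delta> i + \<delta> k + \<delta> l)
          + u k * (\<delta> i + \<delta> j + \<delta> l) + u l * (\<delta> i + \<delta> j + \<delta> k)" (is "0 \<le> ?T")
      proof (rule angle_derivative_form_nonneg[OF _ _ _ _ _ _ _ _ _ uk uk uk uk ww ww ww ww])
        show "S = coth (x s i) + coth (x s j) + coth (x s k) + coth (x s l)"
          using * by (simp add: S_def coth_sum_def)
        show "Q = S^2 - 2*((coth (x s i))^2 + (coth (x s j))^2 + (coth (x s k))^2 + (coth (x s l))^2) + 4"
          unfolding Q_def S_def coth_form_def using * by simp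
        show "P = coth (x s i) * w s i + coth (x s j) * w s j + coth (x s k) * w s k + coth (x s l) * w s l"
          using * by (simp add: P_def)
        show "V = w s i + w s j + w s k + w s l" using * by (simp add: V_def)
        show "0 < Q" using pos by (simp add: Q_def)
      qed (use *(1) in \<open>auto intro!: gt1\<close>)
      \<comment> \<open>Each solid angle contains the corner angles of the other three vertices;
        collecting by \<open>u\<close> turns the derivative into a negative multiple of the form
        treated above.\<close>
      moreover have "(\<Sum>i\<in>\<sigma>. (0 - 2 * (\<Sum>k\<in>\<sigma>-{i}. u k / sqrt Q)) * \<delta> i) = - 2 / sqrt Q * ?T"
      proof -
        have "\<sigma> - {i} = {j, k, l}" "\<sigma> - {j} = {i, k, l}" "\<sigma> - {k} = {i, j, l}" "\<sigma> - {l} = {i, j, k}"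
          using * by auto
        then have "(\<Sum>i\<in>\<sigma>. (0 - 2 * (\<Sum>k\<in>\<sigma>-{i}. u k / sqrt Q)) * \<delta> i)
          = (0 - 2 * (u j / sqrt Q + u k / sqrt Q + u l / sqrt Q)) * \<delta> i
          + (0 - 2 * (u i / sqrt Q + u k / sqrt Q + u l / sqrt Q)) * \<delta> j
          + (0 - 2 * (u i / sqrt Q + u j / sqrt Q + u l / sqrt Q)) * \<delta> k
          + (0 - 2 * (u i / sqrt Q + u j / sqrt Q + u k / sqrt Q)) * \<delta> l"
          using * by (simp add: algebra_simps)
        also have "\<dots> = - 2 / sqrt Q * ?T"
          by (simp add: divide_inverse algebra_simps)
        finally show ?thesis .
      qed
      moreover have "- 2 / sqrt Q \<le> 0" using pos by (simp add: Q_def)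
      ultimately show ?thesis by (simp only: mult_nonpos_nonneg)
    qed
    ultimately show ?thesis by blast
  qed
  have "f 1 \<le> f 0"
    by (rule nonincreasing_off_finite_values[OF _ cont_f \<open>open U\<close> \<open>finite Z\<close> deriv f_degenerate]) auto
  moreover have "x 1 = r'" "x 0 = r" by (auto simp: x_def \<delta>_def)
  ultimately show ?thesis
    by (simp add: f_def \<delta>_def left_diff_distrib sum_subtractf)
qed

section \<open>Monotonicity of the extended curvature\<close>

lemma corner_angle_bounds: "0 \<le> corner_angle S Q y" "corner_angle S Q y \<le> pi"
proof -
  from abs_divide_sqrt_le_1[of "max 0 Q" "S - 2*y"]
  show "0 \<le> corner_angle S Q y" "corner_angle S Q y \<le> pi"
    unfolding corner_angle_def abs_le_iff by (auto intro!: arccos_lbound arccos_ubound)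
qed

text \<open>Three angles between \<open>0\<close> and \<open>pi\<close> give the range from
  \<open>- 4*pi\<close> to \<open>2*pi\<close>; this crude uniform bound is enough for the energy
  estimate.\<close>

lemma abs_packing_angle_le:
  assumes "card \<sigma> = 4" "i \<in> \<sigma>"
  shows "\<bar>packing_angle r \<sigma> i\<bar> \<le> 4*pi"
proof -
  let ?c = "\<lambda>k. corner_angle (coth_sum r \<sigma>) (coth_form r \<sigma>) (coth (r k))"
  have "finite \<sigma>" using assms(1) card.infinite by fastforce
  then have "card (\<sigma> - {i}) = 3" using assms by simp
  have "(\<Sum>k\<in>\<sigma>-{i}. ?c k) \<le> (\<Sum>k\<in>\<sigma>-{i}. pi)"
    by (intro sum_mono corner_angle_bounds)
  then have "(\<Sum>k\<in>\<sigma>-{i}. ?c k) \<le> 3*pi" using \<open>card (\<sigma> - {i}) = 3\<close> by simp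
  moreover have "(\<Sum>k\<in>\<sigma>-{i}. ?c k) \<ge> 0" by (intro sum_nonneg corner_angle_bounds)
  ultimately show ?thesis unfolding packing_angle_def using pi_gt_zero by linarith
qed

text \<open>The triple belonging to a tetrahedron is the sorted list of its vertices other than
  \<open>i\<close>; cardinality \<open>4\<close> excludes repetitions of \<open>i\<close>.\<close>

lemma ordered_triples_bij_betw:
  fixes i :: nat
  assumes "\<And>\<sigma>. \<sigma> \<in> C \<Longrightarrow> card \<sigma> = 4"
  shows "bij_betw (\<lambda>(j, k, l). {i, j, k, l})
    {(j, k, l). j < k \<and> k < l \<and> {i, j, k, l} \<in> C} {\<sigma> \<in> C. i \<in> \<sigma>}"
proof -
  let ?I = "{(j, k, l). j < k \<and> k < l \<and> {i, j, k, l} \<in> C}"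
  have notin: "i \<notin> {j, k, l}" if "{i, j, k, l} \<in> C" for j k l
  proof
    assume "i \<in> {j, k, l}"
    then have "{i, j, k, l} = {j, k, l}" by auto
    moreover have "card {j, k, l} \<le> 3" by (simp add: card_insert_if)
    ultimately show False using assms[OF that] by simp
  qed
  have sorted: "sorted_list_of_set {j, k, l} = [j, k, l]" if "j < k" "k < l" for j k l :: nat
    using that by simp
  have inj: "inj_on (\<lambda>(j, k, l). {i, j, k, l}) ?I"
  proof (rule inj_onI)
    fix t t' assume t: "t \<in> ?I" "t' \<in> ?I"
      and eq': "(\<lambda>(j, k, l). {i, j, k, l}) t = (\<lambda>(j, k, l). {i, j, k, l}) t'"
    obtain j k l j' k' l' where tt: "t = (j, k, l)" "t' = (j', k', l')"
      by (cases t, cases t')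
    have *: "j < k" "k < l" "{i, j, k, l} \<in> C" "j' < k'" "k' < l'" "{i, j', k', l'} \<in> C"
      and eq: "{i, j, k, l} = {i, j', k', l'}"
      using t eq' by (simp_all add: tt)
    have "{j, k, l} = {i, j, k, l} - {i}" using notin[OF *(3)] by auto
    also have "\<dots> = {j', k', l'}" unfolding eq using notin[OF *(6)] by auto
    finally have "{j, k, l} = {j', k', l'}" .
    then have "[j, k, l] = [j', k', l']" using sorted *(1,2,4,5) by metis
    then show "t = t'" by (simp add: tt)
  qed
  have "(\<lambda>(j, k, l). {i, j, k, l}) ` ?I = {\<sigma> \<in> C. i \<in> \<sigma>}"
  proof (intro equalityI subsetI)
    fix \<sigma> assume \<sigma>: "\<sigma> \<in> {\<sigma> \<in> C. i \<in> \<sigma>}"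
    then have "card \<sigma> = 4" "finite \<sigma>" using assms[of \<sigma>] card.infinite by fastforce+
    then have len: "length (sorted_list_of_set (\<sigma> - {i})) = Suc (Suc (Suc 0))" using \<sigma> by simp
    then obtain j k l where jkl: "sorted_list_of_set (\<sigma> - {i}) = [j, k, l]"
      unfolding length_Suc_conv by auto
    have "sorted_wrt (<) [j, k, l]"
      using strict_sorted_list_of_set[of "\<sigma> - {i}"] jkl by simp
    moreover have "\<sigma> - {i} = {j, k, l}"
      using set_sorted_list_of_set[of "\<sigma> - {i}"] jkl \<open>finite \<sigma>\<close> by simp
    then have "{i, j, k, l} = \<sigma>" using \<sigma> by auto
    ultimately have "(j, k, l) \<in> ?I" "\<sigma> = (\<lambda>(j, k, l). {i, j, k, l}) (j, k, l)" using \<sigma> by auto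
    then show "\<sigma> \<in> (\<lambda>(j, k, l). {i, j, k, l}) ` ?I" by (rule rev_image_eqI)
  qed auto
  with inj show ?thesis by (simp add: bij_betw_def)
qed

lemma ext_scalar_curvature_eq:
  assumes complex: "simplicial_complex_on N \<T>" and r: "\<And>m. m \<in> {1..N} \<Longrightarrow> r m > 0"
  shows "ext_scalar_curvature \<T> r i = 4*pi - (\<Sum>\<sigma>\<in>{\<sigma>\<in>simplices \<T> 3. i \<in> \<sigma>}. packing_angle r \<sigma> i)"
proof -
  have card: "card \<sigma> = 4" if "\<sigma> \<in> simplices \<T> 3" for \<sigma> using that by (simp add: simplices_def)
  have pos: "r m > 0" if "\<sigma> \<in> simplices \<T> 3" "m \<in> \<sigma>" for \<sigma> m
    using that complex by (intro r) (auto simp: simplices_def simplicial_complex_on_def)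
  have "(\<Sum>(j, k, l)\<in>{(j, k, l). j < k \<and> k < l \<and> {i, j, k, l} \<in> simplices \<T> 3}.
      ext_solid_angle (r i) (r j) (r k) (r l))
    = (\<Sum>t\<in>{(j, k, l). j < k \<and> k < l \<and> {i, j, k, l} \<in> simplices \<T> 3}.
      packing_angle r ((\<lambda>(j, k, l). {i, j, k, l}) t) i)"
  proof (rule sum.cong[OF refl], clarify)
    fix j k l assume *: "j < k" "k < l" "{i, j, k, l} \<in> simplices \<T> 3"
    have "i \<notin> {j, k, l}"
    proof
      assume "i \<in> {j, k, l}"
      then have "{i, j, k, l} = {j, k, l}" by auto
      then show False using card[OF *(3)] *(1,2) by simp
    qed
    then show "ext_solid_angle (r i) (r j) (r k) (r l) = packing_angle r {i, j, k, l} i"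
      using *(1,2) pos[OF *(3)] by (intro ext_solid_angle_eq_packing_angle) auto
  qed
  also have "\<dots> = (\<Sum>\<sigma>\<in>{\<sigma>\<in>simplices \<T> 3. i \<in> \<sigma>}. packing_angle r \<sigma> i)"
    by (rule sum.reindex_bij_betw[OF ordered_triples_bij_betw[OF card]])
  finally show ?thesis by (simp add: ext_scalar_curvature_def)
qed

lemma finite_simplices:
  assumes "simplicial_complex_on N \<T>"
  shows "finite (simplices \<T> d)"
proof (rule finite_subset)
  show "simplices \<T> d \<subseteq> Pow {1..N}" using assms by (auto simp: simplices_def simplicial_complex_on_def)
qed simp

text \<open>Exchanging the sums over vertices and incident tetrahedra leaves one sum per
  tetrahedron, which is nonpositive by \<open>packing_angle_monotone\<close>. The minus sign in the
  curvature reverses the inequality.\<close>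

lemma ext_scalar_curvature_monotone:
  assumes complex: "simplicial_complex_on N \<T>"
    and r: "\<And>m. m \<in> {1..N} \<Longrightarrow> r m > 0" and r': "\<And>m. m \<in> {1..N} \<Longrightarrow> r' m > 0"
  shows "(\<Sum>i\<in>{1..N}. (ext_scalar_curvature \<T> r' i - ext_scalar_curvature \<T> r i) * (r' i - r i)) \<ge> 0"
proof -
  let ?C = "simplices \<T> 3"
  let ?d = "\<lambda>\<sigma> i. (packing_angle r' \<sigma> i - packing_angle r \<sigma> i) * (r' i - r i)"
  have sub: "\<sigma> \<subseteq> {1..N}" if "\<sigma> \<in> ?C" for \<sigma>
    using that complex by (auto simp: simplices_def simplicial_complex_on_def)
  have K: "ext_scalar_curvature \<T> r i = 4*pi - (\<Sum>\<sigma>\<in>{\<sigma>\<in>?C. i \<in> \<sigma>}. packing_angle r \<sigma> i)" for i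
    using ext_scalar_curvature_eq[of N \<T> r i] complex r by blast
  have K': "ext_scalar_curvature \<T> r' i = 4*pi - (\<Sum>\<sigma>\<in>{\<sigma>\<in>?C. i \<in> \<sigma>}. packing_angle r' \<sigma> i)" for i
    using ext_scalar_curvature_eq[of N \<T> r' i] complex r' by blast
  have "(\<Sum>i\<in>{1..N}. (ext_scalar_curvature \<T> r' i - ext_scalar_curvature \<T> r i) * (r' i - r i))
    = (\<Sum>i\<in>{1..N}. - (\<Sum>\<sigma>\<in>{\<sigma>\<in>?C. i \<in> \<sigma>}. ?d \<sigma> i))"
    unfolding K K'
    by (simp add: sum_subtractf flip: sum_distrib_right) (simp add: algebra_simps)
  also have "\<dots> = - (\<Sum>i\<in>{1..N}. \<Sum>\<sigma>\<in>{\<sigma>\<in>?C. i \<in> \<sigma>}. ?d \<sigma> i)"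
    by (rule sum_negf)
  finally have eq: "(\<Sum>i\<in>{1..N}. (ext_scalar_curvature \<T> r' i - ext_scalar_curvature \<T> r i) * (r' i - r i))
    = - (\<Sum>i\<in>{1..N}. \<Sum>\<sigma>\<in>{\<sigma>\<in>?C. i \<in> \<sigma>}. ?d \<sigma> i)" .
  have "(\<Sum>i\<in>{1..N}. \<Sum>\<sigma>\<in>{\<sigma>\<in>?C. i \<in> \<sigma>}. ?d \<sigma> i) = (\<Sum>\<sigma>\<in>?C. \<Sum>i\<in>{i\<in>{1..N}. i \<in> \<sigma>}. ?d \<sigma> i)"
    by (rule sum.swap_restrict) (simp_all add: finite_simplices[OF complex])
  also have "\<dots> = (\<Sum>\<sigma>\<in>?C. \<Sum>i\<in>\<sigma>. ?d \<sigma> i)"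
  proof (rule sum.cong[OF refl])
    fix \<sigma> assume "\<sigma> \<in> ?C"
    then have "{i\<in>{1..N}. i \<in> \<sigma>} = \<sigma>" using sub by blast
    then show "(\<Sum>i\<in>{i\<in>{1..N}. i \<in> \<sigma>}. ?d \<sigma> i) = (\<Sum>i\<in>\<sigma>. ?d \<sigma> i)" by (simp only:)
  qed
  also have "\<dots> \<le> 0"
  proof (rule sum_nonpos)
    fix \<sigma> assume "\<sigma> \<in> ?C"
    show "(\<Sum>i\<in>\<sigma>. ?d \<sigma> i) \<le> 0"
    proof (rule packing_angle_monotone)
      show "card \<sigma> = 4" using \<open>\<sigma> \<in> ?C\<close> by (simp add: simplices_def)
      show "r i > 0" "r' i > 0" if "i \<in> \<sigma>" for i
        using sub[OF \<open>\<sigma> \<in> ?C\<close>] r r' that by blast+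
    qed
  qed
  finally show ?thesis unfolding eq by simp
qed

lemma abs_ext_scalar_curvature_le:
  assumes complex: "simplicial_complex_on N \<T>" and r: "\<And>m. m \<in> {1..N} \<Longrightarrow> r m > 0"
  shows "\<bar>ext_scalar_curvature \<T> r i\<bar> \<le> 4*pi * (1 + card (simplices \<T> 3))"
proof -
  let ?C = "{\<sigma>\<in>simplices \<T> 3. i \<in> \<sigma>}"
  have "\<bar>\<Sum>\<sigma>\<in>?C. packing_angle r \<sigma> i\<bar> \<le> (\<Sum>\<sigma>\<in>?C. 4*pi)"
    by (intro order.trans[OF sum_abs] sum_mono abs_packing_angle_le) (auto simp: simplices_def)
  also have "\<dots> \<le> 4*pi * card (simplices \<T> 3)"
    using card_mono[OF finite_simplices[OF complex], of ?C] by (auto intro: mult_right_mono)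
  finally have "\<bar>\<Sum>\<sigma>\<in>?C. packing_angle r \<sigma> i\<bar> \<le> 4*pi * card (simplices \<T> 3)" .
  moreover have "ext_scalar_curvature \<T> r i = 4*pi - (\<Sum>\<sigma>\<in>?C. packing_angle r \<sigma> i)"
    using ext_scalar_curvature_eq[of N \<T> r i] complex r by blast
  ultimately show ?thesis
    using abs_triangle_ineq4[of "4*pi" "\<Sum>\<sigma>\<in>?C. packing_angle r \<sigma> i"] by (simp add: distrib_left)
qed

section \<open>Uniqueness of the flow\<close>

lemma abs_sinh_diff_le:
  fixes x y R :: real
  assumes "x \<in> {0..R}" "y \<in> {0..R}"
  shows "\<bar>sinh x - sinh y\<bar> \<le> cosh R * \<bar>x - y\<bar>"
proof -
  have "norm (sinh x - sinh y) \<le> cosh R * norm (x - y)"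
  proof (rule field_differentiable_bound[of "{0..R}"])
    show "(sinh has_field_derivative cosh z) (at z within {0..R})" for z
      by (auto intro!: derivative_eq_intros)
    show "norm (cosh z) \<le> cosh R" if "z \<in> {0..R}" for z
      using that by (simp add: cosh_real_nonneg_le_iff)
  qed (use assms in auto)
  then show ?thesis by simp
qed

text \<open>The product of \<open>E s\<close> with \<open>exp (- C * s)\<close> has nonpositive
  derivative and the same sign as \<open>E s\<close>.\<close>

lemma gronwall_nonpos:
  fixes E E' :: "real \<Rightarrow> real"
  assumes "a \<le> b" and deriv: "\<And>s. s \<in> {a..b} \<Longrightarrow> (E has_real_derivative E' s) (at s within {a..b})"
    and le: "\<And>s. s \<in> {a..b} \<Longrightarrow> E' s \<le> C * E s" and "E a \<le> 0"
  shows "E b \<le> 0"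
proof (cases "a = b")
  case False
  define G where "G = (\<lambda>s. E s * exp (- C * s))"
  have dG: "(G has_real_derivative (E' s - C * E s) * exp (- C * s)) (at s within {a..b})" if "s \<in> {a..b}" for s
    unfolding G_def by (rule derivative_eq_intros deriv[OF that] refl | simp add: algebra_simps)+
  have "G b \<le> G a"
  proof (rule DERIV_nonpos_imp_decreasing_open[of a b G])
    show "continuous_on {a..b} G"
      by (rule DERIV_continuous_on[OF dG])
    fix s assume s: "a < s" "s < b"
    then have "(G has_real_derivative (E' s - C * E s) * exp (- C * s)) (at s)"
      using dG[of s] by (simp add: at_within_Icc_at)
    moreover have "(E' s - C * E s) * exp (- C * s) \<le> 0"
      using le[of s] s by (intro mult_nonpos_nonneg) auto
    ultimately show "\<exists>y. (G has_real_derivative y) (at s) \<and> y \<le> 0" by blast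
  qed (use False \<open>a \<le> b\<close> in auto)
  also have "G a \<le> 0" using \<open>E a \<le> 0\<close> by (simp add: G_def mult_nonpos_nonneg)
  finally show ?thesis by (simp add: G_def mult_le_0_iff)
qed (use assms in simp)

text \<open>The left-hand side is the derivative of \<open>(x - y)^2 / sinh x\<close> along \<open>x' = - K sinh x\<close>, \<open>y' = - L sinh y\<close>;
  the weight \<open>1 / sinh x\<close> is chosen to produce the monotone expression \<open>(K - L) (x - y)\<close>.\<close>

lemma energy_term_derivative_le:
  fixes x y K L \<kappa> R :: real
  assumes x: "x \<in> {0<..R}" and y: "y \<in> {0<..R}" and K: "\<bar>K\<bar> \<le> \<kappa>" and L: "\<bar>L\<bar> \<le> \<kappa>"
  shows "(2 * (x - y) * (L * sinh y - K * sinh x) * sinh x + (x - y)^2 * (cosh x * (K * sinh x))) / (sinh x)^2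
    \<le> - 2 * ((K - L) * (x - y)) + 3 * \<kappa> * cosh R * ((x - y)^2 / sinh x)"
proof -
  have sx: "sinh x > 0" using x by simp
  \<comment> \<open>The split \<open>K * sinh x - L * sinh y = (K - L) * sinh x + L * (sinh x - sinh
    y)\<close> isolates the monotone term. Of the rest, the Lipschitz estimate for
    \<open>sinh\<close> contributes \<open>2 * \<kappa> * cosh R\<close> and the derivative of the
    weight \<open>\<kappa> * cosh R\<close>.\<close>
  have "(2 * (x - y) * (L * sinh y - K * sinh x) * sinh x + (x - y)^2 * (cosh x * (K * sinh x))) / (sinh x)^2
    = - 2 * ((K - L) * (x - y)) + (2 * (x - y) * L * (sinh y - sinh x) + K * cosh x * (x - y)^2) / sinh x"
    using sx by (simp add: power2_eq_square field_simps)
  also have "2 * (x - y) * L * (sinh y - sinh x) \<le> 2 * \<kappa> * cosh R * (x - y)^2"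
  proof -
    have "2 * (x - y) * L * (sinh y - sinh x) \<le> \<bar>2 * (x - y) * L * (sinh y - sinh x)\<bar>" by simp
    also have "\<dots> = 2 * \<bar>x - y\<bar> * (\<bar>L\<bar> * \<bar>sinh y - sinh x\<bar>)" unfolding abs_mult by simp
    also have "\<dots> \<le> 2 * \<bar>x - y\<bar> * (\<kappa> * (cosh R * \<bar>y - x\<bar>))"
      using abs_sinh_diff_le[of y R x] x y L by (intro mult_left_mono mult_mono) auto
    also have "\<dots> = 2 * \<kappa> * cosh R * \<bar>x - y\<bar>^2" by (simp add: power2_eq_square abs_minus_commute)
    finally show ?thesis by simp
  qed
  also have "K * cosh x * (x - y)^2 \<le> \<kappa> * cosh R * (x - y)^2"
    using K x by (intro mult_right_mono mult_mono) (auto simp: cosh_real_nonneg_le_iff)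
  finally show ?thesis
    using sx by (simp add: divide_right_mono algebra_simps add_divide_distrib)
qed

theorem theorem3p13:
  fixes M :: "'m topology" and N :: nat and \<T> :: "nat set set"
    and r0 :: "nat \<Rightarrow> real" and r r' :: "real \<Rightarrow> nat \<Rightarrow> real" and T T' :: ereal
  assumes "triangulated_closed_3_manifold M N \<T>"
    and "\<And>i. i \<in> {1..N} \<Longrightarrow> r0 i > 0"
    and "ext_yamabe_flow_solution N \<T> r0 T r"
    and "ext_yamabe_flow_solution N \<T> r0 T' r'"
  shows "\<forall>t. 0 \<le> t \<and> ereal t < T \<and> ereal t < T' \<longrightarrow> (\<forall>i\<in>{1..N}. r t i = r' t i)"
proof (intro allI impI)
  fix t assume t: "0 \<le> t \<and> ereal t < T \<and> ereal t < T'"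
  have complex: "simplicial_complex_on N \<T>"
    using assms(1) by (simp add: triangulated_closed_3_manifold_def)
  \<comment> \<open>Both solutions are restricted to the compact interval \<open>{0..t}\<close>, on
    which they exist together and are bounded.\<close>
  have restrict: "x s i > 0 \<and> ((\<lambda>s. x s i) has_real_derivative - ext_scalar_curvature \<T> (x s) i * sinh (x s i))
      (at s within {0..t})"
    if sol: "ext_yamabe_flow_solution N \<T> r0 B x" and "ereal t < B" and s: "s \<in> {0..t}" and i: "i \<in> {1..N}"
    for x B s i
  proof -
    have lt: "ereal z < B" if "z \<le> t" for z
      using that \<open>ereal t < B\<close> by (meson ereal_less_eq(3) order.strict_trans1)
    have "{0..t} \<subseteq> {s. 0 \<le> s \<and> ereal s < B}" using lt by auto
    moreover have "x s i > 0 \<and> ((\<lambda>s. x s i) has_real_derivative - ext_scalar_curvature \<T> (x s) i * sinh (x s i))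
        (at s within {s. 0 \<le> s \<and> ereal s < B})"
      using sol lt[of s] s i unfolding ext_yamabe_flow_solution_def by simp
    ultimately show ?thesis by (blast intro: has_field_derivative_subset)
  qed
  define K L where "K = (\<lambda>s. ext_scalar_curvature \<T> (r s))" and "L = (\<lambda>s. ext_scalar_curvature \<T> (r' s))"
  have pos: "r s i > 0" "r' s i > 0"
    and dr: "((\<lambda>s. r s i) has_real_derivative - K s i * sinh (r s i)) (at s within {0..t})"
    and dr': "((\<lambda>s. r' s i) has_real_derivative - L s i * sinh (r' s i)) (at s within {0..t})"
    if "s \<in> {0..t}" "i \<in> {1..N}" for s i
    using restrict[OF assms(3) _ that] restrict[OF assms(4) _ that] t by (auto simp: K_def L_def)
  define \<kappa> where "\<kappa> = 4*pi * (1 + card (simplices \<T> 3))"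
  have bound: "\<bar>K s i\<bar> \<le> \<kappa>" "\<bar>L s i\<bar> \<le> \<kappa>" if "s \<in> {0..t}" for s i
    unfolding K_def L_def \<kappa>_def using pos[OF that] by (intro abs_ext_scalar_curvature_le[OF complex]; simp)+
  obtain R where R: "r s i \<le> R" "r' s i \<le> R" if "s \<in> {0..t}" "i \<in> {1..N}" for s i
  proof -
    have "continuous_on {0..t} (\<lambda>s. r s i)" "continuous_on {0..t} (\<lambda>s. r' s i)" if "i \<in> {1..N}" for i
      by (rule DERIV_continuous_on, erule dr[OF _ that]) (rule DERIV_continuous_on, erule dr'[OF _ that])
    then have bd: "bounded ((\<lambda>s. r s i) ` {0..t})" "bounded ((\<lambda>s. r' s i) ` {0..t})" if "i \<in> {1..N}" for i
      using that by (simp_all only: compact_imp_bounded[OF compact_continuous_image[OF _ compact_Icc]])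
    have "bounded (\<Union>i\<in>{1..N}. (\<lambda>s. r s i) ` {0..t})"
      by (intro bounded_UN ballI finite_atLeastAtMost) (erule bd(1))
    moreover have "bounded (\<Union>i\<in>{1..N}. (\<lambda>s. r' s i) ` {0..t})"
      by (intro bounded_UN ballI finite_atLeastAtMost) (erule bd(2))
    ultimately have "bounded ((\<Union>i\<in>{1..N}. (\<lambda>s. r s i) ` {0..t}) \<union> (\<Union>i\<in>{1..N}. (\<lambda>s. r' s i) ` {0..t}))"
      (is "bounded ?A") by (rule bounded_Un[THEN iffD2, OF conjI])
    then have "\<exists>R. \<forall>z\<in>?A. norm z \<le> R" by (rule bounded_iff[THEN iffD1])
    then obtain R where R: "\<forall>z\<in>?A. norm z \<le> R" ..
    show ?thesis
    proof (rule that[of R])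
      fix s i assume "s \<in> {0..t}" "i \<in> {1..N}"
      then have "norm (r s i) \<le> R" "norm (r' s i) \<le> R" by (intro bspec[OF R]; blast)+
      then show "r s i \<le> R" "r' s i \<le> R" by simp_all
    qed
  qed
  \<comment> \<open>This is the constant of \<open>energy_term_derivative_le\<close>. No lower bound
    on the radii enters, since \<open>1 / sinh (r s i)\<close> remains inside the energy.\<close>
  define C where "C = 3 * \<kappa> * cosh R"
  define E where "E = (\<lambda>s. \<Sum>i\<in>{1..N}. (r s i - r' s i)^2 / sinh (r s i))"
  define E' where "E' = (\<lambda>s. \<Sum>i\<in>{1..N}.
    (2 * (r s i - r' s i) * (L s i * sinh (r' s i) - K s i * sinh (r s i)) * sinh (r s i)
      + (r s i - r' s i)^2 * (cosh (r s i) * (K s i * sinh (r s i)))) / (sinh (r s i))^2)"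
  have "E t \<le> 0"
  proof (rule gronwall_nonpos[of 0 t E E' C])
    show "0 \<le> t" using t by simp
    show "E 0 \<le> 0"
      using assms(3,4) by (simp add: E_def ext_yamabe_flow_solution_def)
    fix s assume s: "s \<in> {0..t}"
    show "(E has_real_derivative E' s) (at s within {0..t})"
      unfolding E_def E'_def
    proof (rule DERIV_sum)
      fix i assume i: "i \<in> {1..N}"
      have "sinh (r s i) \<noteq> 0" using pos(1)[OF s i] by simp
      then show "((\<lambda>s. (r s i - r' s i)^2 / sinh (r s i)) has_real_derivative
        (2 * (r s i - r' s i) * (L s i * sinh (r' s i) - K s i * sinh (r s i)) * sinh (r s i)
          + (r s i - r' s i)^2 * (cosh (r s i) * (K s i * sinh (r s i)))) / (sinh (r s i))^2) (at s within {0..t})"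
        by (auto intro!: derivative_eq_intros dr[OF s i] dr'[OF s i] simp: power2_eq_square algebra_simps)
    qed
    have "E' s \<le> (\<Sum>i\<in>{1..N}. - 2 * ((K s i - L s i) * (r s i - r' s i)) + C * ((r s i - r' s i)^2 / sinh (r s i)))"
      unfolding E'_def C_def
      using pos[OF s] R[OF s] bound[OF s] by (intro sum_mono energy_term_derivative_le) auto
    also have "\<dots> = - 2 * (\<Sum>i\<in>{1..N}. (K s i - L s i) * (r s i - r' s i)) + C * E s"
      unfolding E_def sum_distrib_left sum.distrib ..
    \<comment> \<open>Monotonicity of the curvature lets the first sum be dropped.\<close>
    also have "\<dots> \<le> C * E s"
      using ext_scalar_curvature_monotone[OF complex, of "r' s" "r s"] pos[OF s] by (simp add: K_def L_def)
    finally show "E' s \<le> C * E s" .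
  qed
  show "\<forall>i\<in>{1..N}. r t i = r' t i"
  proof
    fix i assume i: "i \<in> {1..N}"
    have nonneg: "(r t i - r' t i)^2 / sinh (r t i) \<ge> 0" if "i \<in> {1..N}" for i
      using pos(1)[of t i] t that by simp
    have "E t = 0"
      using \<open>E t \<le> 0\<close> nonneg unfolding E_def by (intro order.antisym sum_nonneg)
    then have "(r t i - r' t i)^2 / sinh (r t i) = 0"
      using nonneg i unfolding E_def by (subst (asm) sum_nonneg_eq_0_iff) auto
    then show "r t i = r' t i" using pos(1)[of t i] t i by simp
  qed
qed

end
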